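(* Let $\Bbbk$ be a field. There is a natural isomorphism $$\mathsf{NCoalg}(\mathsf{Alg}_\Bbbk)\big(A,C^{\bullet}\big)\;\cong\;\mathsf{NAlg}(\mathsf{Coalg}_\Bbbk)\big(C,A^{\circ}\big)$$ for every pair of objects $A$ in $\mathsf{NCoalg}(\mathsf{Alg}_\Bbbk)$ and $C$ in $\mathsf{NAlg}(\mathsf{Coalg}_\Bbbk)$. That is, the contravariant functors $(-)^{\bullet}:\mathsf{NAlg}(\mathsf{Coalg}_\Bbbk)\to\mathsf{NCoalg}(\mathsf{Alg}_\Bbbk)$ and $(-)^{\circ}:\mathsf{NCoalg}(\mathsf{Alg}_\Bbbk)\to\mathsf{NAlg}(\mathsf{Coalg}_\Bbbk)$ form a contravariant adjunction.
   Context: All vector spaces are over the field $\Bbbk$, $\otimes=\otimes_\Bbbk$, $V^*=\mathrm{Hom}_\Bbbk(V,\Bbbk)$; $\varphi_{V,W}:V^*\otimes W^*\to(V\otimes W)^*$ is the canonical injection $f\otimes g\mapsto[v\otimes w\mapsto f(v)g(w)]$. A non-associative algebra is a vector space with a bilinear multiplication having a two-sided unit, not necessarily associative. A non-coassociative coalgebra is a vector space with a comultiplication having a two-sided counit, not necessarily coassociative. $\mathsf{NAlg}(\mathsf{Coalg}_\Bbbk)$: objects are $(C,\Delta,\varepsilon,m,u)$ with $(C,\Delta,\varepsilon)$ a coassociative counital coalgebra and $m:C\otimes C\to C$, $u:\Bbbk\to C$ coalgebra maps such that $m$ is unital with unit $u$ ($m$ need not be associative). $\mathsf{NCoalg}(\mathsf{Alg}_\Bbbk)$: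 objects are $(A,m,u,\Delta,\varepsilon)$ with $(A,m,u)$ an associative unital algebra and $\Delta:A\to A\otimes A$, $\varepsilon:A\to\Bbbk$ algebra maps such that $\Delta$ is counital with counit $\varepsilon$ ($\Delta$ need not be coassociative). In both categories, morphisms are linear maps compatible with multiplication, unit, comultiplication and counit. For a non-associative algebra $(A,m,u)$, a subspace $V\subseteq A^*$ is good if $m^*(V)\subseteq\varphi_{A,A}(V\otimes V)$; $A^{\bullet}$ is the sum of all good subspaces of $A^*$ (it is the largest good subspace). It is a non-coassociative coalgebra with comultiplication determined by $f(ab)=\sum f_1(a)f_2(b)$ and counit $f\mapsto f(1)$. If $A$ is associative one writes $A^{\circ}$ for it; then $A^\circ=\{f\in A^*\mid \ker f$ contains a two-sided ideal of finite codimension$\}$ is the usual finite dual. If $C$ is in $\mathsf{NAlg}(\mathsf{Coalg}_\Bbbk)$, then $C^{\bullet}$ is the object of $\mathsf{NCoalg}(\mathsf{Alg}_\Bbbk)$ with comultiplication $f\mapsto\sum f_1\otimes f_2$ determined by $f(xy)=\sum f_1(x)f_2(y)$ for all $x,y\in C$ and counit $f\mapsto f(1)$ (coming from the algebra structure of $C$), convolution product $(f*g)(x)=\sum f(x_1)g(x_2)$ and unit $\varepsilon$. If $A$ is in $\mathsf{NCoalg}(\mathsf{Alg}_\Bbbk)$, then $A^{\circ}$ is the object of $\mathsf{NAlg}(\mathsf{Coalg}_\Bbbk)$ with comultiplication $f\mapsto\sum f_1\otimes f_2$ determined by $f(ab)=\sum f_1(a)f_2(b)$ for all $a,b\in A$,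 counit $f\mapsto f(1)$, convolution product $(f*g)(a)=\sum f(a_1)g(a_2)$ and unit $\varepsilon$. On morphisms both functors are given by restriction of the transpose $h\mapsto h\circ f$. *)

theory Defs
  imports Complex_Main "HOL-Library.Function_Algebras"
begin

section \<open>Vector spaces and linear maps\<close>

text \<open>
  A vector space over the field \<open>'k\<close> is a subspace \<open>carrier\<close> of a type \<open>'v\<close> on which a scalar
  multiplication in the sense of the locale \<^locale>\<open>vector_space\<close> is given. Carriers are needed because
  the dual objects below are proper subspaces of function types.
\<close>

record ('k, 'v) vspace =
  carrier :: "'v set"
  smult :: "'k \<Rightarrow> 'v \<Rightarrow> 'v"

definition is_vspace :: "('k::field, 'v::ab_group_add, 'x) vspace_scheme \<Rightarrow> bool" where
  "is_vspace V \<longleftrightarrow> vector_space (smult V) \<and> module.subspace (smult V) (carrier V)"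

definition linear_map ::
  "('k::field, 'v::ab_group_add, 'x) vspace_scheme \<Rightarrow> ('k, 'w::ab_group_add, 'y) vspace_scheme
    \<Rightarrow> ('v \<Rightarrow> 'w) \<Rightarrow> bool" where
  "linear_map V W f \<longleftrightarrow>
     (\<forall>x\<in>carrier V. f x \<in> carrier W) \<and>
     (\<forall>x\<in>carrier V. \<forall>y\<in>carrier V. f (x + y) = f x + f y) \<and>
     (\<forall>r. \<forall>x\<in>carrier V. f (smult V r x) = smult W r (f x))"

text \<open>
  Maps that are to be compared or collected into sets are normalised to vanish outside the carrier,
  so that equality of HOL functions is equality of maps on the carrier.
\<close>

definition Lin ::
  "('k::field, 'v::ab_group_add, 'x) vspace_scheme \<Rightarrow> ('k, 'w::ab_group_add, 'y) vspace_scheme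
    \<Rightarrow> ('v \<Rightarrow> 'w) set" where
  "Lin V W = {f. linear_map V W f \<and> (\<forall>x. x \<notin> carrier V \<longrightarrow> f x = 0)}"

definition id_map :: "('k::field, 'v::ab_group_add, 'x) vspace_scheme \<Rightarrow> 'v \<Rightarrow> 'v" where
  "id_map V = (\<lambda>x. if x \<in> carrier V then x else 0)"

definition fscale :: "'k::field \<Rightarrow> ('v \<Rightarrow> 'k) \<Rightarrow> 'v \<Rightarrow> 'k" where
  "fscale r f = (\<lambda>x. r * f x)"

definition base :: "('k::field, 'k) vspace" where
  "base = \<lparr>carrier = UNIV, smult = (*)\<rparr>"

definition dual :: "('k::field, 'v::ab_group_add, 'x) vspace_scheme \<Rightarrow> ('k, 'v \<Rightarrow> 'k) vspace" where
  "dual V = \<lparr>carrier = Lin V base, smult = fscale\<rparr>"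

text \<open>The transpose \<open>f\<^sup>* : W\<^sup>* \<rightarrow> V\<^sup>*\<close> of a linear map \<open>f : V \<rightarrow> W\<close>.\<close>

definition transpose_map ::
  "('k::field, 'v::ab_group_add, 'x) vspace_scheme \<Rightarrow> ('v \<Rightarrow> 'w) \<Rightarrow> ('w \<Rightarrow> 'k) \<Rightarrow> 'v \<Rightarrow> 'k" where
  "transpose_map V f h = (\<lambda>x. if x \<in> carrier V then h (f x) else 0)"


section \<open>Tensor products\<close>

text \<open>
  The pure tensor \<open>v \<otimes> w\<close> is realised as evaluation of bilinear forms at \<open>(v, w)\<close>, and \<open>V \<otimes> W\<close> as the
  span of the pure tensors inside the dual of the space of bilinear forms. It suffices to use forms
  on the ambient types, since over a field bilinear forms on subspaces extend. Consequently, for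
  subspaces \<open>V' \<subseteq> V\<close> and \<open>W' \<subseteq> W\<close>, \<open>V' \<otimes> W'\<close> is literally a subspace of \<open>V \<otimes> W\<close>. That this is a tensor
  product is the universal property \<open>tensor_universal\<close> below.
\<close>

type_synonym ('k, 'v, 'w) tensor = "('v \<Rightarrow> 'w \<Rightarrow> 'k) \<Rightarrow> 'k"

definition bilinear_form ::
  "('k::field, 'v::ab_group_add, 'x) vspace_scheme \<Rightarrow> ('k, 'w::ab_group_add, 'y) vspace_scheme
    \<Rightarrow> ('v \<Rightarrow> 'w \<Rightarrow> 'k) \<Rightarrow> bool" where
  "bilinear_form V W B \<longleftrightarrow>
     (\<forall>w. Vector_Spaces.linear (smult V) (*) (\<lambda>v. B v w)) \<and>
     (\<forall>v. Vector_Spaces.linear (smult W) (*) (\<lambda>w. B v w))"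

definition tens ::
  "('k::field, 'v::ab_group_add, 'x) vspace_scheme \<Rightarrow> ('k, 'w::ab_group_add, 'y) vspace_scheme
    \<Rightarrow> 'v \<Rightarrow> 'w \<Rightarrow> ('k, 'v, 'w) tensor" where
  "tens V W v w = (\<lambda>B. if bilinear_form V W B then B v w else 0)"

definition tensor ::
  "('k::field, 'v::ab_group_add, 'x) vspace_scheme \<Rightarrow> ('k, 'w::ab_group_add, 'y) vspace_scheme
    \<Rightarrow> ('k, ('k, 'v, 'w) tensor) vspace" where
  "tensor V W =
     \<lparr>carrier = module.span fscale {tens V W v w | v w. v \<in> carrier V \<and> w \<in> carrier W},
      smult = fscale\<rparr>"

definition bilinear_map ::
  "('k::field, 'v::ab_group_add, 'x) vspace_scheme \<Rightarrow> ('k, 'w::ab_group_add, 'y) vspace_scheme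
    \<Rightarrow> ('k, 'u::ab_group_add, 'z) vspace_scheme \<Rightarrow> ('v \<Rightarrow> 'w \<Rightarrow> 'u) \<Rightarrow> bool" where
  "bilinear_map V W U b \<longleftrightarrow>
     (\<forall>w\<in>carrier W. linear_map V U (\<lambda>v. b v w)) \<and>
     (\<forall>v\<in>carrier V. linear_map W U (\<lambda>w. b v w))"

text \<open>The linear map \<open>V \<otimes> W \<rightarrow> U\<close> induced by a bilinear map \<open>b : V \<times> W \<rightarrow> U\<close>.\<close>

definition lift ::
  "('k::field, 'v::ab_group_add, 'x) vspace_scheme \<Rightarrow> ('k, 'w::ab_group_add, 'y) vspace_scheme
    \<Rightarrow> ('k, 'u::ab_group_add, 'z) vspace_scheme \<Rightarrow> ('v \<Rightarrow> 'w \<Rightarrow> 'u) \<Rightarrow> ('k, 'v, 'w) tensor \<Rightarrow> 'u" where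
  "lift V W U b =
     (THE h. h \<in> Lin (tensor V W) U \<and>
             (\<forall>v\<in>carrier V. \<forall>w\<in>carrier W. h (tens V W v w) = b v w))"

lemma vector_space_fscale: "vector_space (fscale :: 'k::field \<Rightarrow> ('v \<Rightarrow> 'k) \<Rightarrow> 'v \<Rightarrow> 'k)"
  by unfold_locales (auto simp: fscale_def fun_eq_iff algebra_simps)

lemma vector_space_times: "vector_space ((*) :: 'k::field \<Rightarrow> 'k \<Rightarrow> 'k)"
  by unfold_locales (auto simp: algebra_simps)

lemma is_vspace_base: "is_vspace (base :: ('k::field, 'k) vspace)"
proof -
  interpret vector_space "(*) :: 'k \<Rightarrow> 'k \<Rightarrow> 'k" by (rule vector_space_times)
  show ?thesis
    using subspace_UNIV vector_space_axioms by (simp add: is_vspace_def base_def)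
qed

lemma is_vspace_tensor:
  fixes V :: "('k::field, 'v::ab_group_add, 'x) vspace_scheme"
    and W :: "('k, 'w::ab_group_add, 'y) vspace_scheme"
  shows "is_vspace (tensor V W)"
proof -
  interpret vector_space "fscale :: 'k \<Rightarrow> ('k,'v,'w) tensor \<Rightarrow> ('k,'v,'w) tensor"
    by (rule vector_space_fscale)
  show ?thesis
    using subspace_span vector_space_axioms by (simp add: is_vspace_def tensor_def)
qed

lemma tens_in_tensor:
  fixes V :: "('k::field, 'v::ab_group_add, 'x) vspace_scheme"
    and W :: "('k, 'w::ab_group_add, 'y) vspace_scheme"
  assumes "v \<in> carrier V" "w \<in> carrier W"
  shows "tens V W v w \<in> carrier (tensor V W)"
proof -
  interpret vector_space "fscale :: 'k \<Rightarrow> ('k,'v,'w) tensor \<Rightarrow> ('k,'v,'w) tensor"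
    by (rule vector_space_fscale)
  have "tens V W v w \<in> span {tens V W v w | v w. v \<in> carrier V \<and> w \<in> carrier W}"
    by (rule span_base) (use assms in blast)
  thus ?thesis by (simp add: tensor_def)
qed

lemma Lin_tensor_eqI:
  fixes V :: "('k::field, 'v::ab_group_add, 'x) vspace_scheme"
    and W :: "('k, 'w::ab_group_add, 'y) vspace_scheme"
    and U :: "('k, 'u::ab_group_add, 'z) vspace_scheme"
  assumes U: "is_vspace U"
    and h: "h \<in> Lin (tensor V W) U" and h': "h' \<in> Lin (tensor V W) U"
    and eq: "\<And>v w. v \<in> carrier V \<Longrightarrow> w \<in> carrier W \<Longrightarrow> h (tens V W v w) = h' (tens V W v w)"
  shows "h = h'"
proof -
  interpret F: vector_space "fscale :: 'k \<Rightarrow> ('k,'v,'w) tensor \<Rightarrow> ('k,'v,'w) tensor"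
    by (rule vector_space_fscale)
  interpret U: vector_space "smult U" using U by (simp add: is_vspace_def)
  let ?S = "{tens V W v w | v w. v \<in> carrier V \<and> w \<in> carrier W}"
  have c: "carrier (tensor V W) = F.span ?S" and s: "smult (tensor V W) = fscale"
    by (simp_all add: tensor_def)
  let ?E = "{t \<in> F.span ?S. h t = h' t}"
  have z: "k 0 = 0" if "k \<in> Lin (tensor V W) U" for k
  proof -
    have "k (0 + 0) = k 0 + k 0"
      using that F.span_zero[of ?S] unfolding Lin_def linear_map_def c by blast
    thus ?thesis by simp
  qed
  have "F.subspace ?E"
    using h h' z[OF h] z[OF h']
    by (auto simp: F.subspace_def F.span_zero F.span_add F.span_scale Lin_def linear_map_def c s)
  moreover have "?S \<subseteq> ?E" using eq by (auto intro: F.span_base)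
  ultimately have "F.span ?S \<subseteq> ?E" by (rule F.span_minimal[rotated])
  thus ?thesis using h h' by (fastforce simp: Lin_def c fun_eq_iff)
qed

lemma ex_projection:
  assumes "is_vspace V"
  obtains p where "Vector_Spaces.linear (smult V) (smult V) p"
    and "\<And>x. p x \<in> carrier V" and "\<And>x. x \<in> carrier V \<Longrightarrow> p x = x"
proof -
  interpret vector_space "smult V" using assms by (simp add: is_vspace_def)
  interpret vector_space_pair "smult V" "smult V" ..
  have "\<exists>g. g ` UNIV \<subseteq> carrier V \<and> Vector_Spaces.linear (smult V) (smult V) g \<and>
          (\<forall>v\<in>carrier V. g (id v) = v)"
    by (rule linear_exists_left_inverse_on[OF linear_id])
      (use assms in \<open>auto simp: is_vspace_def\<close>)
  then obtain g where g: "g ` UNIV \<subseteq> carrier V" "Vector_Spaces.linear (smult V) (smult V) g"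
    "\<forall>v\<in>carrier V. g (id v) = v" by blast
  show ?thesis by (rule that[of g]) (use g in auto)
qed

theorem tensor_universal:
  fixes V :: "('k::field, 'v::ab_group_add, 'x) vspace_scheme"
    and W :: "('k, 'w::ab_group_add, 'y) vspace_scheme"
    and U :: "('k, 'u::ab_group_add, 'z) vspace_scheme"
  assumes V: "is_vspace V" and W: "is_vspace W" and U: "is_vspace U"
    and b: "bilinear_map V W U b"
  shows "\<exists>!h. h \<in> Lin (tensor V W) U \<and>
           (\<forall>v\<in>carrier V. \<forall>w\<in>carrier W. h (tens V W v w) = b v w)"
proof (rule ex_ex1I)
  interpret F: vector_space "fscale :: 'k \<Rightarrow> ('k,'v,'w) tensor \<Rightarrow> ('k,'v,'w) tensor"
    by (rule vector_space_fscale)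
  interpret K: vector_space "(*) :: 'k \<Rightarrow> 'k \<Rightarrow> 'k" by (rule vector_space_times)
  interpret V: vector_space "smult V" using V by (simp add: is_vspace_def)
  interpret W: vector_space "smult W" using W by (simp add: is_vspace_def)
  interpret U: vector_space "smult U" using U by (simp add: is_vspace_def)
  interpret FU: vector_space_pair "fscale :: 'k \<Rightarrow> ('k,'v,'w) tensor \<Rightarrow> ('k,'v,'w) tensor" "smult U" ..
  interpret FK: vector_space_pair "fscale :: 'k \<Rightarrow> ('k,'v,'w) tensor \<Rightarrow> ('k,'v,'w) tensor" "(*)" ..
  interpret UK: vector_space_pair "smult U" "(*) :: 'k \<Rightarrow> 'k \<Rightarrow> 'k" ..
  let ?S = "{tens V W v w | v w. v \<in> carrier V \<and> w \<in> carrier W}"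
  have c: "carrier (tensor V W) = F.span ?S" and s: "smult (tensor V W) = fscale"
    by (simp_all add: tensor_def)
  obtain p where p: "Vector_Spaces.linear (smult V) (smult V) p"
    "\<And>x. p x \<in> carrier V" "\<And>x. x \<in> carrier V \<Longrightarrow> p x = x"
    using ex_projection[OF V] by blast
  obtain q where q: "Vector_Spaces.linear (smult W) (smult W) q"
    "\<And>x. q x \<in> carrier W" "\<And>x. x \<in> carrier W \<Longrightarrow> q x = x"
    using ex_projection[OF W] by blast
  obtain D where D: "D \<subseteq> ?S" "F.independent D" "?S \<subseteq> F.span D"
    by (rule F.maximal_independent_subset)
  have "\<forall>t\<in>D. \<exists>vw. t = tens V W (fst vw) (snd vw) \<and> fst vw \<in> carrier V \<and> snd vw \<in> carrier W"
    using D(1) by fastforce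
  then obtain r where r: "\<And>t. t \<in> D \<Longrightarrow> t = tens V W (fst (r t)) (snd (r t))"
      "\<And>t. t \<in> D \<Longrightarrow> fst (r t) \<in> carrier V \<and> snd (r t) \<in> carrier W"
    by metis
  obtain h where h: "Vector_Spaces.linear fscale (smult U) h"
      "\<forall>t\<in>D. h t = b (fst (r t)) (snd (r t))"
    using FU.linear_independent_extend[OF D(2), of "\<lambda>t. b (fst (r t)) (snd (r t))"] by blast
  have key: "h (tens V W v w) = b v w" if vw: "v \<in> carrier V" "w \<in> carrier W" for v w
  proof (rule ccontr)
    assume ne: "h (tens V W v w) \<noteq> b v w"
    define u where "u = h (tens V W v w) - b v w"
    have "U.independent {u}" using ne by (simp add: u_def)
    then obtain g where g: "Vector_Spaces.linear (smult U) (*) g" "g u = (1::'k)"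
      using UK.linear_independent_extend[of "{u}" "\<lambda>_. 1"] by auto
    interpret g: Vector_Spaces.linear "smult U" "(*)" g by (rule g(1))
    interpret p: Vector_Spaces.linear "smult V" "smult V" p by (rule p(1))
    interpret q: Vector_Spaces.linear "smult W" "smult W" q by (rule q(1))
    define B where "B = (\<lambda>x y. g (b (p x) (q y)))"
    have B: "bilinear_form V W B"
      unfolding bilinear_form_def B_def
      by (intro conjI allI; unfold_locales)
        (use b p(2) q(2) in \<open>auto simp: bilinear_map_def linear_map_def p.add p.scale q.add q.scale
            g.add g.scale algebra_simps\<close>)
    have ev: "Vector_Spaces.linear fscale (*) (\<lambda>t :: ('k,'v,'w) tensor. t B)"
      by unfold_locales (auto simp: fscale_def)
    have gh: "Vector_Spaces.linear fscale (*) (g \<circ> h)"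
      using Vector_Spaces.linear_compose[OF h(1) g(1)] .
    have "(g \<circ> h) (tens V W v w) = tens V W v w B"
    proof (rule FK.linear_eq_on[OF gh ev, of _ D])
      show "tens V W v w \<in> F.span D" using D(3) vw by blast
      fix t assume t: "t \<in> D"
      have "t B = B (fst (r t)) (snd (r t))"
        by (subst r(1)[OF t]) (simp add: tens_def B)
      thus "(g \<circ> h) t = t B" using h(2) t r(2)[OF t] by (simp add: B_def p(3) q(3))
    qed
    also have "\<dots> = g (b v w)" using vw by (simp add: tens_def B) (simp add: B_def p(3) q(3))
    finally have "g u = 0" by (simp add: u_def g.diff)
    thus False using g(2) by simp
  qed
  interpret h: Vector_Spaces.linear fscale "smult U" h by (rule h(1))
  have "F.span ?S \<subseteq> h -` carrier U"
  proof (rule F.span_minimal)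
    show "?S \<subseteq> h -` carrier U" using key b by (auto simp: bilinear_map_def linear_map_def)
    show "F.subspace (h -` carrier U)"
      using U by (auto simp: is_vspace_def F.subspace_def U.subspace_def h.add h.scale h.zero)
  qed
  hence "(\<lambda>t. if t \<in> carrier (tensor V W) then h t else 0) \<in> Lin (tensor V W) U"
    by (auto simp: Lin_def linear_map_def c s F.span_add F.span_scale h.add h.scale)
  thus "\<exists>h. h \<in> Lin (tensor V W) U \<and> (\<forall>v\<in>carrier V. \<forall>w\<in>carrier W. h (tens V W v w) = b v w)"
    using key tens_in_tensor[of _ V _ W] by (intro exI conjI) auto
next
  fix h h'
  assume "h \<in> Lin (tensor V W) U \<and> (\<forall>v\<in>carrier V. \<forall>w\<in>carrier W. h (tens V W v w) = b v w)"
    and "h' \<in> Lin (tensor V W) U \<and> (\<forall>v\<in>carrier V. \<forall>w\<in>carrier W. h' (tens V W v w) = b v w)"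
  thus "h = h'" by (intro Lin_tensor_eqI[OF U]) auto
qed

lemma bilinear_map_tens: "bilinear_map V W (tensor V W) (tens V W)"
proof -
  have "B (x + y) w = B x w + B y w" "B (smult V r x) w = r * B x w"
    "B v (x' + y') = B v x' + B v y'" "B v (smult W r x') = r * B v x'"
    if "bilinear_form V W B" for B x y w r v x' y'
  proof -
    interpret l: Vector_Spaces.linear "smult V" "(*)" "\<lambda>v. B v w"
      using that by (simp add: bilinear_form_def)
    interpret r: Vector_Spaces.linear "smult W" "(*)" "B v"
      using that by (simp add: bilinear_form_def)
    show "B (x + y) w = B x w + B y w" "B (smult V r x) w = r * B x w"
      "B v (x' + y') = B v x' + B v y'" "B v (smult W r x') = r * B v x'"
      by (rule l.add l.scale r.add r.scale)+
  qed
  hence "tens V W (x + y) w = tens V W x w + tens V W y w"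
    "tens V W (smult V r x) w = fscale r (tens V W x w)"
    "tens V W v (x' + y') = tens V W v x' + tens V W v y'"
    "tens V W v (smult W r x') = fscale r (tens V W v x')" for x y w r v x' y'
    unfolding tens_def fscale_def by (auto simp: fun_eq_iff)
  moreover have "smult (tensor V W) = fscale" by (simp add: tensor_def)
  ultimately show ?thesis
    by (simp add: bilinear_map_def linear_map_def tens_in_tensor)
qed

text \<open>\<open>f \<otimes> g : V \<otimes> W \<rightarrow> V' \<otimes> W'\<close>\<close>

definition tmap ::
  "('k::field, 'v::ab_group_add, 'x) vspace_scheme \<Rightarrow> ('k, 'w::ab_group_add, 'y) vspace_scheme
    \<Rightarrow> ('k, 'v1::ab_group_add, 'x1) vspace_scheme \<Rightarrow> ('k, 'w1::ab_group_add, 'y1) vspace_scheme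
    \<Rightarrow> ('v \<Rightarrow> 'v1) \<Rightarrow> ('w \<Rightarrow> 'w1) \<Rightarrow> ('k, 'v, 'w) tensor \<Rightarrow> ('k, 'v1, 'w1) tensor" where
  "tmap V W V' W' f g = lift V W (tensor V' W') (\<lambda>v w. tens V' W' (f v) (g w))"

text \<open>The associativity isomorphism \<open>(V \<otimes> W) \<otimes> U \<rightarrow> V \<otimes> (W \<otimes> U)\<close>.\<close>

definition tassoc ::
  "('k::field, 'v::ab_group_add, 'x) vspace_scheme \<Rightarrow> ('k, 'w::ab_group_add, 'y) vspace_scheme
    \<Rightarrow> ('k, 'u::ab_group_add, 'z) vspace_scheme
    \<Rightarrow> ('k, ('k, 'v, 'w) tensor, 'u) tensor \<Rightarrow> ('k, 'v, ('k, 'w, 'u) tensor) tensor" where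
  "tassoc V W U =
     lift (tensor V W) U (tensor V (tensor W U))
       (\<lambda>t u. lift V W (tensor V (tensor W U))
                (\<lambda>v w. tens V (tensor W U) v (tens W U w u)) t)"

text \<open>The middle interchange
  \<open>(V \<otimes> W) \<otimes> (V' \<otimes> W') \<rightarrow> (V \<otimes> V') \<otimes> (W \<otimes> W')\<close>,
  \<open>(v \<otimes> w) \<otimes> (v' \<otimes> w') \<mapsto> (v \<otimes> v') \<otimes> (w \<otimes> w')\<close>.\<close>

definition interchange ::
  "('k::field, 'v::ab_group_add, 'x) vspace_scheme \<Rightarrow> ('k, 'w::ab_group_add, 'y) vspace_scheme
    \<Rightarrow> ('k, 'v1::ab_group_add, 'x1) vspace_scheme \<Rightarrow> ('k, 'w1::ab_group_add, 'y1) vspace_scheme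
    \<Rightarrow> ('k, ('k, 'v, 'w) tensor, ('k, 'v1, 'w1) tensor) tensor
    \<Rightarrow> ('k, ('k, 'v, 'v1) tensor, ('k, 'w, 'w1) tensor) tensor" where
  "interchange V W V' W' =
     (let T = tensor (tensor V V') (tensor W W') in
      lift (tensor V W) (tensor V' W') T
        (\<lambda>t t'. lift V W T
           (\<lambda>v w. lift V' W' T
              (\<lambda>v' w'. tens (tensor V V') (tensor W W') (tens V V' v v') (tens W W' w w')) t') t))"

text \<open>The canonical injection \<open>\<phi>\<^bsub>V,W\<^esub> : V\<^sup>* \<otimes> W\<^sup>* \<rightarrow> (V \<otimes> W)\<^sup>*\<close>.\<close>

definition phi ::
  "('k::field, 'v::ab_group_add, 'x) vspace_scheme \<Rightarrow> ('k, 'w::ab_group_add, 'y) vspace_scheme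
    \<Rightarrow> ('k, 'v \<Rightarrow> 'k, 'w \<Rightarrow> 'k) tensor \<Rightarrow> ('k, 'v, 'w) tensor \<Rightarrow> 'k" where
  "phi V W = lift (dual V) (dual W) (dual (tensor V W))
               (\<lambda>f g. lift V W base (\<lambda>v w. f v * g w))"


section \<open>Algebras, coalgebras and the two categories\<close>

text \<open>
  One record holds the data \<open>(m, u, \<Delta>, \<epsilon>)\<close>; each predicate below refers only to the
  components it needs. The product \<open>xy\<close> is \<open>m (x \<otimes> y)\<close> and the unit element is \<open>u 1\<close>.
\<close>

record ('k, 'v) bistruct = "('k, 'v) vspace" +
  mul :: "('k, 'v, 'v) tensor \<Rightarrow> 'v"
  unit :: "'k \<Rightarrow> 'v"
  comul :: "'v \<Rightarrow> ('k, 'v, 'v) tensor"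
  counit :: "'v \<Rightarrow> 'k"

definition nonassoc_algebra :: "('k::field, 'v::ab_group_add) bistruct \<Rightarrow> bool" where
  "nonassoc_algebra A \<longleftrightarrow>
     is_vspace A \<and> linear_map (tensor A A) A (mul A) \<and> linear_map base A (unit A) \<and>
     (\<forall>x\<in>carrier A. mul A (tens A A (unit A 1) x) = x \<and> mul A (tens A A x (unit A 1)) = x)"

definition associative :: "('k::field, 'v::ab_group_add) bistruct \<Rightarrow> bool" where
  "associative A \<longleftrightarrow>
     (\<forall>x\<in>carrier A. \<forall>y\<in>carrier A. \<forall>z\<in>carrier A.
        mul A (tens A A (mul A (tens A A x y)) z) = mul A (tens A A x (mul A (tens A A y z))))"

definition noncoassoc_coalgebra :: "('k::field, 'v::ab_group_add) bistruct \<Rightarrow> bool" where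
  "noncoassoc_coalgebra C \<longleftrightarrow>
     is_vspace C \<and> linear_map C (tensor C C) (comul C) \<and> linear_map C base (counit C) \<and>
     (\<forall>x\<in>carrier C.
        lift C C C (\<lambda>y z. smult C (counit C y) z) (comul C x) = x \<and>
        lift C C C (\<lambda>y z. smult C (counit C z) y) (comul C x) = x)"

definition coassociative :: "('k::field, 'v::ab_group_add) bistruct \<Rightarrow> bool" where
  "coassociative C \<longleftrightarrow>
     (\<forall>x\<in>carrier C.
        tassoc C C C (tmap C C (tensor C C) C (comul C) (id_map C) (comul C x)) =
        tmap C C C (tensor C C) (id_map C) (comul C) (comul C x))"

definition algebra_map ::
  "('k::field, 'v::ab_group_add) bistruct \<Rightarrow> ('k, 'w::ab_group_add) bistruct
    \<Rightarrow> ('v \<Rightarrow> 'w) \<Rightarrow> bool" where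
  "algebra_map A B f \<longleftrightarrow>
     linear_map A B f \<and>
     (\<forall>t\<in>carrier (tensor A A). f (mul A t) = mul B (tmap A A B B f f t)) \<and>
     (\<forall>r. f (unit A r) = unit B r)"

definition coalgebra_map ::
  "('k::field, 'v::ab_group_add) bistruct \<Rightarrow> ('k, 'w::ab_group_add) bistruct
    \<Rightarrow> ('v \<Rightarrow> 'w) \<Rightarrow> bool" where
  "coalgebra_map C D f \<longleftrightarrow>
     linear_map C D f \<and>
     (\<forall>x\<in>carrier C. comul D (f x) = tmap C C D D f f (comul C x)) \<and>
     (\<forall>x\<in>carrier C. counit D (f x) = counit C x)"

text \<open>The base field and tensor products, with their usual algebra and coalgebra structures.\<close>

definition ground :: "('k::field, 'k) bistruct" where
  "ground = \<lparr>carrier = UNIV, smult = (*),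
     mul = lift base base base (*), unit = (\<lambda>r. r),
     comul = (\<lambda>r. fscale r (tens base base 1 1)), counit = (\<lambda>r. r)\<rparr>"

definition tensor_struct ::
  "('k::field, 'v::ab_group_add) bistruct \<Rightarrow> ('k, 'w::ab_group_add) bistruct
    \<Rightarrow> ('k, ('k, 'v, 'w) tensor) bistruct" where
  "tensor_struct A B = \<lparr>carrier = carrier (tensor A B), smult = smult (tensor A B),
     mul = (\<lambda>t. tmap (tensor A A) (tensor B B) A B (mul A) (mul B) (interchange A B A B t)),
     unit = (\<lambda>r. fscale r (tens A B (unit A 1) (unit B 1))),
     comul = (\<lambda>t. interchange A A B B (tmap A B (tensor A A) (tensor B B) (comul A) (comul B) t)),
     counit = lift A B base (\<lambda>x y. counit A x * counit B y)\<rparr>"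

text \<open>Objects of \<open>NAlg(Coalg)\<close> and of \<open>NCoalg(Alg)\<close>.\<close>

definition NAlg_Coalg :: "('k::field, 'v::ab_group_add) bistruct \<Rightarrow> bool" where
  "NAlg_Coalg C \<longleftrightarrow>
     noncoassoc_coalgebra C \<and> coassociative C \<and> nonassoc_algebra C \<and>
     coalgebra_map (tensor_struct C C) C (mul C) \<and> coalgebra_map ground C (unit C)"

definition NCoalg_Alg :: "('k::field, 'v::ab_group_add) bistruct \<Rightarrow> bool" where
  "NCoalg_Alg A \<longleftrightarrow>
     nonassoc_algebra A \<and> associative A \<and> noncoassoc_coalgebra A \<and>
     algebra_map A (tensor_struct A A) (comul A) \<and> algebra_map A ground (counit A)"

text \<open>The set of morphisms, in either category.\<close>

definition Mor ::
  "('k::field, 'v::ab_group_add) bistruct \<Rightarrow> ('k, 'w::ab_group_add) bistruct \<Rightarrow> ('v \<Rightarrow> 'w) set" where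
  "Mor A B = {f \<in> Lin A B. algebra_map A B f \<and> coalgebra_map A B f}"


section \<open>Good subspaces and the dual functors\<close>

definition good :: "('k::field, 'v::ab_group_add) bistruct \<Rightarrow> ('v \<Rightarrow> 'k) set \<Rightarrow> bool" where
  "good A V \<longleftrightarrow>
     V \<subseteq> carrier (dual A) \<and> module.subspace fscale V \<and>
     (let V' = \<lparr>carrier = V, smult = fscale\<rparr> in
      transpose_map (tensor A A) (mul A) ` V \<subseteq> phi A A ` carrier (tensor V' V'))"

text \<open>The sum of all good subspaces.\<close>

definition bullet_space ::
  "('k::field, 'v::ab_group_add) bistruct \<Rightarrow> ('k, 'v \<Rightarrow> 'k) vspace" where
  "bullet_space A = \<lparr>carrier = module.span fscale (\<Union>{V. good A V}), smult = fscale\<rparr>"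

text \<open>
  The multiplication is the convolution \<open>f * g = \<phi>(f \<otimes> g) \<circ> \<Delta>\<close>, and the comultiplication sends \<open>f\<close>
  to the unique \<open>t\<close> with \<open>\<phi> t = f \<circ> m\<close>.
\<close>

definition bullet :: "('k::field, 'v::ab_group_add) bistruct \<Rightarrow> ('k, 'v \<Rightarrow> 'k) bistruct" where
  "bullet A = \<lparr>carrier = carrier (bullet_space A), smult = fscale,
     mul = (\<lambda>t. transpose_map A (comul A) (phi A A t)),
     unit = (\<lambda>r. fscale r (transpose_map A (counit A) (\<lambda>s. s))),
     comul = (\<lambda>f. THE t. t \<in> carrier (tensor (bullet_space A) (bullet_space A)) \<and>
                          phi A A t = transpose_map (tensor A A) (mul A) f),
     counit = (\<lambda>f. f (unit A 1))\<rparr>"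

text \<open>For an associative algebra \<open>A\<close>, \<open>A\<^sup>\<bullet>\<close> is written \<open>A\<^sup>\<circ>\<close>.\<close>

abbreviation (input) circ :: "('k::field, 'v::ab_group_add) bistruct \<Rightarrow> ('k, 'v \<Rightarrow> 'k) bistruct" where
  "circ A \<equiv> bullet A"

text \<open>The restricted transpose \<open>B\<^sup>\<bullet> \<rightarrow> A\<^sup>\<bullet>\<close>, \<open>h \<mapsto> h \<circ> f\<close>, of a morphism \<open>f : A \<rightarrow> B\<close>.\<close>

definition bullet_map ::
  "('k::field, 'v::ab_group_add) bistruct \<Rightarrow> ('k, 'w::ab_group_add) bistruct
    \<Rightarrow> ('v \<Rightarrow> 'w) \<Rightarrow> ('w \<Rightarrow> 'k) \<Rightarrow> 'v \<Rightarrow> 'k" where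
  "bullet_map A B f = (\<lambda>h. if h \<in> carrier (bullet B) then transpose_map A f h else 0)"

abbreviation (input) circ_map ::
  "('k::field, 'v::ab_group_add) bistruct \<Rightarrow> ('k, 'w::ab_group_add) bistruct
    \<Rightarrow> ('v \<Rightarrow> 'w) \<Rightarrow> ('w \<Rightarrow> 'k) \<Rightarrow> 'v \<Rightarrow> 'k" where
  "circ_map A B f \<equiv> bullet_map A B f"

text \<open>
  The transposition \<open>f \<mapsto> [c \<mapsto> [a \<mapsto> f(a)(c)]]\<close>, for \<open>f : A \<rightarrow> C\<^sup>\<bullet>\<close>. By the normalisation of maps it
  vanishes outside the carriers without further provision.
\<close>

definition adj :: "('a \<Rightarrow> 'c \<Rightarrow> 'k) \<Rightarrow> 'c \<Rightarrow> 'a \<Rightarrow> 'k" where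
  "adj f = (\<lambda>c a. f a c)"

end

(* If a linear map F from a coalgebra D to A* satisfies F(d)(ab) = sum F(d1)(a) F(d2)(b), then its
   image is a good subspace, and F is a coalgebra map into A^bullet.
   Under the exchange f(a)(c) = F(c)(a) this condition on F says that f is multiplicative for the
   convolution product, and symmetrically the multiplicativity of F says that f is comultiplicative.
   Neither direction uses (co)associativity, so one argument serves both functors; associativity of
   a product and coassociativity of the dual coproduct correspond by evaluating at a, b, c.
   Identities in A^bullet (x) A^bullet are tested by evaluation at pairs of elements, which is
   faithful because the functionals p (x) q separate the points of a tensor product over a field. *)

theory Submission
  imports Defs
begin

section \<open>Linear maps and tensor products\<close>

text \<open>For associative algebras the finite dual is described by ideals of finite codimension;
  here membership is shown by exhibiting a good subspace. The working criterion is a set S of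
  functionals in which every f satisfies f(xy) = \<Sum> g_i(x) h_i(y) with all g_i and h_i again in
  S. Its span W is then good, because the functionals whose composite with m lies in the image of W
  \<otimes> W under \<phi> form a subspace. The image of F is such a set, and so are {\<epsilon>}
  and the set of all convolution products of elements of \<open>bullet A\<close>. That m is a
  coalgebra map and that \<Delta> is an algebra map are the same equation, both sides containing the
  same middle interchange. Hence the two categories share one self-dual predicate,
  \<open>bialgebra\<close>, and differ only in which of associativity and coassociativity is added.
  The coproduct of \<open>bullet A\<close> is a definite description, so each identity for it rests
  on the injectivity of \<phi>. The exchange \<open>adj\<close> is its own inverse, so a single
  preservation lemma, used with both orders of the two objects, gives the bijection.\<close>

lemma
  assumes "is_vspace V"
  shows vspace_zero: "0 \<in> carrier V"
    and vspace_add: "x \<in> carrier V \<Longrightarrow> y \<in> carrier V \<Longrightarrow> x + y \<in> carrier V"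
    and vspace_scale: "x \<in> carrier V \<Longrightarrow> smult V r x \<in> carrier V"
    and vspace_diff: "x \<in> carrier V \<Longrightarrow> y \<in> carrier V \<Longrightarrow> x - y \<in> carrier V"
    and vspace_sum: "(\<And>i. i \<in> I \<Longrightarrow> g i \<in> carrier V) \<Longrightarrow> sum g I \<in> carrier V"
proof -
  interpret vector_space "smult V" using assms by (simp add: is_vspace_def)
  have s: "subspace (carrier V)" using assms by (simp add: is_vspace_def)
  show "0 \<in> carrier V" using s by (rule subspace_0)
  show "x \<in> carrier V \<Longrightarrow> y \<in> carrier V \<Longrightarrow> x + y \<in> carrier V" using s by (rule subspace_add)
  show "x \<in> carrier V \<Longrightarrow> smult V r x \<in> carrier V" using s by (rule subspace_scale)
  show "x \<in> carrier V \<Longrightarrow> y \<in> carrier V \<Longrightarrow> x - y \<in> carrier V" using s by (rule subspace_diff)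
  show "(\<And>i. i \<in> I \<Longrightarrow> g i \<in> carrier V) \<Longrightarrow> sum g I \<in> carrier V" using s by (rule subspace_sum)
qed

lemmas vspace_closed = vspace_zero vspace_add vspace_scale vspace_diff vspace_sum

lemma vspace_vector_space: "is_vspace V \<Longrightarrow> vector_space (smult V)"
  by (simp add: is_vspace_def)

lemma
  assumes "linear_map V W f"
  shows linear_map_closed: "x \<in> carrier V \<Longrightarrow> f x \<in> carrier W"
    and linear_map_add: "x \<in> carrier V \<Longrightarrow> y \<in> carrier V \<Longrightarrow> f (x + y) = f x + f y"
    and linear_map_scale: "x \<in> carrier V \<Longrightarrow> f (smult V r x) = smult W r (f x)"
  using assms by (auto simp: linear_map_def)

lemma linear_map_zero:
  assumes "is_vspace V" "linear_map V W f"
  shows "f 0 = 0"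
  using linear_map_add[OF assms(2) vspace_zero[OF assms(1)] vspace_zero[OF assms(1)]] by simp

lemma linear_map_sum:
  assumes V: "is_vspace V" and f: "linear_map V W f" and g: "\<And>i. i \<in> I \<Longrightarrow> g i \<in> carrier V"
  shows "f (sum g I) = (\<Sum>i\<in>I. f (g i))"
proof -
  have "sum g I \<in> carrier V \<and> f (sum g I) = (\<Sum>i\<in>I. f (g i))"
    using g
  proof (induction I rule: infinite_finite_induct)
    case (insert i I)
    thus ?case using linear_map_add[OF f] vspace_add[OF V] by simp
  qed (simp_all add: linear_map_zero[OF V f] vspace_zero[OF V])
  thus ?thesis ..
qed

lemma linear_map_cong:
  assumes "is_vspace V" "linear_map V W f" "\<And>x. x \<in> carrier V \<Longrightarrow> f x = g x"
  shows "linear_map V W g"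
  using assms by (auto simp: linear_map_def vspace_closed)

lemma LinD: "f \<in> Lin V W \<Longrightarrow> linear_map V W f" "f \<in> Lin V W \<Longrightarrow> x \<notin> carrier V \<Longrightarrow> f x = 0"
  by (auto simp: Lin_def)

lemma Lin_eqI:
  assumes "f \<in> Lin V W" "g \<in> Lin V W" "\<And>x. x \<in> carrier V \<Longrightarrow> f x = g x"
  shows "f = g"
proof
  fix x show "f x = g x" using assms by (cases "x \<in> carrier V") (auto simp: LinD)
qed

lemma carrier_base [simp]: "carrier base = UNIV" and smult_base [simp]: "smult base = (*)"
  by (simp_all add: base_def)

lemma smult_dual [simp]: "smult (dual V) = fscale" and carrier_dual: "carrier (dual V) = Lin V base"
  by (simp_all add: dual_def)

lemma smult_tensor [simp]: "smult (tensor V W) = fscale"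
  by (simp add: tensor_def)

lemma fscale_apply [simp]: "fscale r f x = r * f x"
  by (simp add: fscale_def)

lemma fscale_fscale: "fscale r (fscale s f) = fscale (r * s) f"
  by (auto simp: fun_eq_iff algebra_simps)

lemma sum_fun_apply: "(sum g I) x = (\<Sum>i\<in>I. g i x)"
  by (induction I rule: infinite_finite_induct) simp_all

lemma is_vspace_dual:
  fixes V :: "('k::field, 'v::ab_group_add, 'x) vspace_scheme"
  assumes "is_vspace V"
  shows "is_vspace (dual V)"
proof -
  interpret F: vector_space "fscale :: 'k \<Rightarrow> ('v \<Rightarrow> 'k) \<Rightarrow> 'v \<Rightarrow> 'k" by (rule vector_space_fscale)
  have "F.subspace (Lin V base)"
    by (auto simp: F.subspace_def Lin_def linear_map_def algebra_simps)
  thus ?thesis by (simp add: is_vspace_def carrier_dual F.vector_space_axioms)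
qed

lemma linear_map_mult:
  assumes "linear_map V base f"
  shows "linear_map V base (\<lambda>x. c * f x)" "linear_map V base (\<lambda>x. f x * c)"
  using assms by (auto simp: linear_map_def algebra_simps)

lemma linear_map_id_map: "is_vspace V \<Longrightarrow> linear_map V V (id_map V)"
  by (simp add: linear_map_def id_map_def vspace_closed)

section \<open>Pure tensors and their dependence on the underlying spaces\<close>

lemma
  fixes V :: "('k::field, 'v::ab_group_add, 'x) vspace_scheme"
    and W :: "('k, 'w::ab_group_add, 'y) vspace_scheme"
  shows tens_add_left: "tens V W (x + y) w = tens V W x w + tens V W y w"
    and tens_add_right: "tens V W v (x' + y') = tens V W v x' + tens V W v y'"
    and tens_scale_left: "tens V W (smult V r x) w = fscale r (tens V W x w)"
    and tens_scale_right: "tens V W v (smult W r x') = fscale r (tens V W v x')"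
proof -
  have "B (x + y) w = B x w + B y w" "B (smult V r x) w = r * B x w"
    "B v (x' + y') = B v x' + B v y'" "B v (smult W r x') = r * B v x'"
    if "bilinear_form V W B" for B
  proof -
    interpret l: Vector_Spaces.linear "smult V" "(*)" "\<lambda>v. B v w"
      using that by (simp add: bilinear_form_def)
    interpret r: Vector_Spaces.linear "smult W" "(*)" "B v"
      using that by (simp add: bilinear_form_def)
    show "B (x + y) w = B x w + B y w" "B (smult V r x) w = r * B x w"
      "B v (x' + y') = B v x' + B v y'" "B v (smult W r x') = r * B v x'"
      by (rule l.add l.scale r.add r.scale)+
  qed
  thus "tens V W (x + y) w = tens V W x w + tens V W y w"
    "tens V W v (x' + y') = tens V W v x' + tens V W v y'"
    "tens V W (smult V r x) w = fscale r (tens V W x w)"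
    "tens V W v (smult W r x') = fscale r (tens V W v x')"
    unfolding tens_def by (auto simp: fun_eq_iff)
qed

lemma tens_zero [simp]: "tens V W 0 w = 0" "tens V W v 0 = 0"
  using tens_add_left[of V W 0 0 w] tens_add_right[of V W v 0 0] by auto

lemma tens_sum_right: "tens V W v (sum g I) = (\<Sum>i\<in>I. tens V W v (g i))"
  by (induction I rule: infinite_finite_induct) (simp_all add: tens_add_right)

text \<open>\<open>bilinear_form\<close> refers to the scalar multiplications alone. Pure tensors
  over \<open>bullet A\<close>, \<open>bullet_space A\<close>, \<open>dual A\<close> and any
  subspace of functionals are therefore the same objects, which lets identities move between these
  records.\<close>

lemma tens_cong:
  assumes "smult V = smult V'" "smult W = smult W'"
  shows "tens V W = tens V' W'"
  unfolding tens_def bilinear_form_def assms ..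

text \<open>Larger carriers only enlarge the set of spanning pure tensors. Through this inclusion
  results about \<open>dual A\<close> \<otimes> \<open>dual A\<close>, injectivity of \<phi> above
  all, apply to tensors over \<open>bullet A\<close>.\<close>

lemma carrier_tensor_mono:
  fixes V :: "('k::field, 'v::ab_group_add, 'x) vspace_scheme"
    and W :: "('k, 'w::ab_group_add, 'y) vspace_scheme"
  assumes "carrier V \<subseteq> carrier V'" "carrier W \<subseteq> carrier W'" "smult V = smult V'" "smult W = smult W'"
  shows "carrier (tensor V W) \<subseteq> carrier (tensor V' W')"
proof -
  interpret vector_space "fscale :: 'k \<Rightarrow> ('k, 'v, 'w) tensor \<Rightarrow> _" by (rule vector_space_fscale)
  show ?thesis
    unfolding tensor_def tens_cong[OF assms(3,4)] vspace.simps
    by (rule span_mono) (use assms(1,2) in blast)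
qed

lemma tensor_cong:
  assumes "carrier V = carrier V'" "smult V = smult V'" "carrier W = carrier W'" "smult W = smult W'"
  shows "tensor V W = tensor V' W'"
  unfolding tensor_def assms(1,3) tens_cong[OF assms(2,4)] ..

lemma linear_map_cong_vspace:
  assumes "carrier V = carrier V'" "smult V = smult V'" "carrier W = carrier W'" "smult W = smult W'"
  shows "linear_map V W = linear_map V' W'"
  unfolding linear_map_def assms ..

lemma lift_cong:
  assumes "carrier V = carrier V'" "smult V = smult V'" "carrier W = carrier W'" "smult W = smult W'"
    "carrier U = carrier U'" "smult U = smult U'"
  shows "lift V W U = lift V' W' U'"
  unfolding lift_def Lin_def assms(1,3) tensor_cong[OF assms(1-4)] tens_cong[OF assms(2,4)]
    linear_map_cong_vspace[OF refl refl assms(5,6)] ..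

lemma tmap_cong:
  assumes "carrier V = carrier V'" "smult V = smult V'" "carrier W = carrier W'" "smult W = smult W'"
    "carrier X = carrier X'" "smult X = smult X'" "carrier Y = carrier Y'" "smult Y = smult Y'"
  shows "tmap V W X Y = tmap V' W' X' Y'"
  unfolding tmap_def tensor_cong[OF assms(5-8)] tens_cong[OF assms(6,8)]
    lift_cong[OF assms(1-4) refl refl] ..

text \<open>The families are total with all values in the carriers, so later membership facts carry
  no bound on the index.\<close>

lemma tensor_expand:
  fixes V :: "('k::field, 'v::ab_group_add, 'x) vspace_scheme"
    and W :: "('k, 'w::ab_group_add, 'y) vspace_scheme"
  assumes V: "is_vspace V" and W: "is_vspace W" and t: "t \<in> carrier (tensor V W)"
  obtains a b and n :: nat where "\<And>i. a i \<in> carrier V" "\<And>i. b i \<in> carrier W"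
    "t = (\<Sum>i<n. tens V W (a i) (b i))"
proof -
  interpret vector_space "fscale :: 'k \<Rightarrow> ('k, 'v, 'w) tensor \<Rightarrow> _" by (rule vector_space_fscale)
  let ?S = "{tens V W v w | v w. v \<in> carrier V \<and> w \<in> carrier W}"
  have "t \<in> span ?S" using t by (simp add: tensor_def)
  hence "\<exists>(n::nat) a b. (\<forall>i. a i \<in> carrier V) \<and> (\<forall>i. b i \<in> carrier W) \<and>
           t = (\<Sum>i<n. tens V W (a i) (b i))"
  proof (induction rule: span_induct_alt)
    case base
    show ?case using V W by (intro exI[of _ 0] exI[of _ "\<lambda>_. 0"]) (auto simp: vspace_closed)
  next
    case (step c x y)
    then obtain v w n a b where vw: "x = tens V W v w" "v \<in> carrier V" "w \<in> carrier W"
      and ab: "\<forall>i::nat. a i \<in> carrier V" "\<forall>i. b i \<in> carrier W" "y = (\<Sum>i<n. tens V W (a i) (b i))"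
      by blast
    \<comment> \<open>The new term takes index \<open>n\<close>, just past the old sum, and the
      scalar \<open>c\<close> is absorbed into its left factor.\<close>
    have "fscale c x + y = (\<Sum>i<Suc n. tens V W ((a(n := smult V c v)) i) ((b(n := w)) i))"
      by (simp add: vw(1) ab(3) tens_scale_left add.commute)
    moreover have "\<forall>i. (a(n := smult V c v)) i \<in> carrier V" "\<forall>i. (b(n := w)) i \<in> carrier W"
      using ab vw V by (auto simp: vspace_closed)
    ultimately show ?case by blast
  qed
  thus ?thesis using that by blast
qed

lemma linear_map_tensor_eq:
  assumes V: "is_vspace V" and W: "is_vspace W"
    and h: "linear_map (tensor V W) U h" and h': "linear_map (tensor V W) U' h'"
    and eq: "\<And>v w. v \<in> carrier V \<Longrightarrow> w \<in> carrier W \<Longrightarrow> h (tens V W v w) = h' (tens V W v w)"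
    and t: "t \<in> carrier (tensor V W)"
  shows "h t = h' t"
proof -
  obtain a b and n :: nat where ab: "\<And>i. a i \<in> carrier V" "\<And>i. b i \<in> carrier W"
    "t = (\<Sum>i<n. tens V W (a i) (b i))"
    by (rule tensor_expand[OF V W t]) (rule that)
  thus ?thesis
    by (simp add: linear_map_sum[OF is_vspace_tensor h] linear_map_sum[OF is_vspace_tensor h']
        tens_in_tensor eq)
qed

section \<open>Maps induced by the universal property\<close>

lemma
  assumes "is_vspace V" "is_vspace W" "is_vspace U" "bilinear_map V W U b"
  shows lift_in_Lin: "lift V W U b \<in> Lin (tensor V W) U"
    and lift_tens: "v \<in> carrier V \<Longrightarrow> w \<in> carrier W \<Longrightarrow> lift V W U b (tens V W v w) = b v w"
  using theI'[OF tensor_universal[OF assms]] unfolding lift_def by auto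

lemmas linear_map_lift = LinD(1)[OF lift_in_Lin]

lemma lift_sum:
  assumes "is_vspace V" "is_vspace W" "is_vspace U" "bilinear_map V W U b"
    and "\<And>i. i \<in> I \<Longrightarrow> x i \<in> carrier V" "\<And>i. i \<in> I \<Longrightarrow> y i \<in> carrier W"
  shows "lift V W U b (\<Sum>i\<in>I. tens V W (x i) (y i)) = (\<Sum>i\<in>I. b (x i) (y i))"
  using assms
  by (simp add: linear_map_sum[OF is_vspace_tensor linear_map_lift[OF assms(1-4)]]
      tens_in_tensor lift_tens)

lemma bilinear_map_mult:
  assumes "linear_map V base f" "linear_map W base g"
  shows "bilinear_map V W base (\<lambda>v w. f v * g w)"
  using assms by (simp add: bilinear_map_def linear_map_mult)

lemma linear_map_compose:
  assumes "linear_map V W f" "linear_map W U g"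
  shows "linear_map V U (\<lambda>x. g (f x))"
  using assms by (auto simp: linear_map_def)

lemma linear_map_tens:
  shows "v \<in> carrier V \<Longrightarrow> linear_map W (tensor V W) (tens V W v)"
    and "w \<in> carrier W \<Longrightarrow> linear_map V (tensor V W) (\<lambda>v. tens V W v w)"
  using bilinear_map_tens[of V W] by (auto simp: bilinear_map_def)

lemma bilinear_map_tens_compose:
  assumes "linear_map V V' f" "linear_map W W' g"
  shows "bilinear_map V W (tensor V' W') (\<lambda>v w. tens V' W' (f v) (g w))"
  using assms by (auto simp: bilinear_map_def linear_map_closed
      intro!: linear_map_compose[OF _ linear_map_tens(1)] linear_map_compose[OF _ linear_map_tens(2)])

lemma
  assumes "is_vspace V" "is_vspace W" "linear_map V V' f" "linear_map W W' g"
  shows linear_map_tmap: "linear_map (tensor V W) (tensor V' W') (tmap V W V' W' f g)"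
    and tmap_tens: "v \<in> carrier V \<Longrightarrow> w \<in> carrier W \<Longrightarrow>
      tmap V W V' W' f g (tens V W v w) = tens V' W' (f v) (g w)"
    and tmap_sum: "(\<And>i. i \<in> I \<Longrightarrow> x i \<in> carrier V) \<Longrightarrow> (\<And>i. i \<in> I \<Longrightarrow> y i \<in> carrier W) \<Longrightarrow>
      tmap V W V' W' f g (\<Sum>i\<in>I. tens V W (x i) (y i)) = (\<Sum>i\<in>I. tens V' W' (f (x i)) (g (y i)))"
  unfolding tmap_def
  by (rule linear_map_lift lift_tens lift_sum; use assms in
      \<open>simp add: is_vspace_tensor bilinear_map_tens_compose\<close>)+

text \<open>For a fixed \<open>t\<close>, a finite expansion turns the lift into a finite sum of
  maps linear in the parameter. This makes nested lifts bilinear, as in \<open>interchange\<close>,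
  \<open>tassoc\<close> and \<open>phi\<close>.\<close>

lemma linear_map_lift_param:
  assumes V: "is_vspace V" and W: "is_vspace W" and U: "is_vspace U"
    and bil: "\<And>x. x \<in> carrier X \<Longrightarrow> bilinear_map V W U (b x)"
    and lin: "\<And>v w. v \<in> carrier V \<Longrightarrow> w \<in> carrier W \<Longrightarrow> linear_map X U (\<lambda>x. b x v w)"
    and X: "is_vspace X" and t: "t \<in> carrier (tensor V W)"
  shows "linear_map X U (\<lambda>x. lift V W U (b x) t)"
proof -
  interpret vector_space "smult U" using U by (rule vspace_vector_space)
  obtain c d and n :: nat where cd: "\<And>i. c i \<in> carrier V" "\<And>i. d i \<in> carrier W"
    "t = (\<Sum>i<n. tens V W (c i) (d i))"
    by (rule tensor_expand[OF V W t]) (rule that)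
  have "lift V W U (b x) t = (\<Sum>i<n. b x (c i) (d i))" if "x \<in> carrier X" for x
    unfolding cd(3) by (rule lift_sum) (use assms that cd in auto)
  moreover have "linear_map X U (\<lambda>x. \<Sum>i<n. b x (c i) (d i))"
    using lin[OF cd(1,2)] U
    by (auto simp: linear_map_def sum.distrib scale_sum_right intro: vspace_sum)
  ultimately show ?thesis using linear_map_cong[OF X] by force
qed

text \<open>Each level of the nested lift is linear in the remaining variables by
  \<open>linear_map_lift_param\<close>. The formula takes sums in both arguments because it will be
  applied to two expanded coproducts.\<close>

lemma
  assumes V: "is_vspace V" and W: "is_vspace W" and V': "is_vspace V'" and W': "is_vspace W'"
  shows linear_map_interchange: "linear_map (tensor (tensor V W) (tensor V' W'))
      (tensor (tensor V V') (tensor W W')) (interchange V W V' W')"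
    and interchange_sum: "(\<And>i. i \<in> I \<Longrightarrow> a i \<in> carrier V) \<Longrightarrow> (\<And>i. i \<in> I \<Longrightarrow> b i \<in> carrier W) \<Longrightarrow>
      (\<And>j. j \<in> J \<Longrightarrow> c j \<in> carrier V') \<Longrightarrow> (\<And>j. j \<in> J \<Longrightarrow> d j \<in> carrier W') \<Longrightarrow>
      interchange V W V' W' (tens (tensor V W) (tensor V' W')
        (\<Sum>i\<in>I. tens V W (a i) (b i)) (\<Sum>j\<in>J. tens V' W' (c j) (d j))) =
      (\<Sum>i\<in>I. \<Sum>j\<in>J. tens (tensor V V') (tensor W W') (tens V V' (a i) (c j)) (tens W W' (b i) (d j)))"
proof -
  let ?T = "tensor (tensor V V') (tensor W W')"
  let ?b = "\<lambda>v w v' w'. tens (tensor V V') (tensor W W') (tens V V' v v') (tens W W' w w')"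
  let ?l = "\<lambda>t v w. lift V' W' ?T (?b v w) t"
  have T: "is_vspace ?T" by (rule is_vspace_tensor)
  have b1: "bilinear_map V' W' ?T (?b v w)" if "v \<in> carrier V" "w \<in> carrier W" for v w
    using that by (intro bilinear_map_tens_compose linear_map_tens)
  have b2: "bilinear_map V W ?T (\<lambda>v w. ?b v w v' w')" if "v' \<in> carrier V'" "w' \<in> carrier W'" for v' w'
    using that by (intro bilinear_map_tens_compose linear_map_tens)
  have bl: "bilinear_map V W ?T (?l t)" if "t \<in> carrier (tensor V' W')" for t
    unfolding bilinear_map_def
    using b1 b2 that V W V' W' by (auto intro!: linear_map_lift_param T simp: bilinear_map_def)
  have bil: "bilinear_map (tensor V W) (tensor V' W') ?T (\<lambda>t t'. lift V W ?T (?l t') t)"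
    unfolding bilinear_map_def
  proof (intro conjI ballI)
    fix t assume "t \<in> carrier (tensor V' W')"
    show "linear_map (tensor V W) ?T (lift V W ?T (?l t))"
      by (rule linear_map_lift) (use V W T bl in \<open>simp_all add: \<open>t \<in> _\<close>\<close>)
  next
    fix t assume "t \<in> carrier (tensor V W)"
    show "linear_map (tensor V' W') ?T (\<lambda>t'. lift V W ?T (?l t') t)"
      by (rule linear_map_lift_param)
        (use V W V' W' T bl b1 in \<open>simp_all add: \<open>t \<in> _\<close> is_vspace_tensor linear_map_lift\<close>)
  qed
  thus "linear_map (tensor (tensor V W) (tensor V' W')) ?T (interchange V W V' W')"
    unfolding interchange_def Let_def by (intro linear_map_lift is_vspace_tensor)
  assume abcd: "\<And>i. i \<in> I \<Longrightarrow> a i \<in> carrier V" "\<And>i. i \<in> I \<Longrightarrow> b i \<in> carrier W"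
    "\<And>j. j \<in> J \<Longrightarrow> c j \<in> carrier V'" "\<And>j. j \<in> J \<Longrightarrow> d j \<in> carrier W'"
  hence t: "(\<Sum>i\<in>I. tens V W (a i) (b i)) \<in> carrier (tensor V W)"
    "(\<Sum>j\<in>J. tens V' W' (c j) (d j)) \<in> carrier (tensor V' W')"
    by (auto intro!: vspace_sum is_vspace_tensor tens_in_tensor)
  with bil have "interchange V W V' W' (tens (tensor V W) (tensor V' W')
      (\<Sum>i\<in>I. tens V W (a i) (b i)) (\<Sum>j\<in>J. tens V' W' (c j) (d j))) =
      lift V W ?T (?l (\<Sum>j\<in>J. tens V' W' (c j) (d j))) (\<Sum>i\<in>I. tens V W (a i) (b i))"
    by (simp add: interchange_def Let_def lift_tens is_vspace_tensor)
  also have "\<dots> = (\<Sum>i\<in>I. ?l (\<Sum>j\<in>J. tens V' W' (c j) (d j)) (a i) (b i))"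
    by (rule lift_sum) (use V W T bl[OF t(2)] abcd in auto)
  also have "\<dots> = (\<Sum>i\<in>I. \<Sum>j\<in>J. ?b (a i) (b i) (c j) (d j))"
    by (intro sum.cong refl lift_sum) (use assms abcd b1 T in auto)
  finally show "interchange V W V' W' (tens (tensor V W) (tensor V' W')
      (\<Sum>i\<in>I. tens V W (a i) (b i)) (\<Sum>j\<in>J. tens V' W' (c j) (d j))) =
    (\<Sum>i\<in>I. \<Sum>j\<in>J. ?b (a i) (b i) (c j) (d j))" .
qed

text \<open>The left factor is a sum because in the coassociativity law it is the expanded coproduct
  of an element.\<close>

lemma
  assumes V: "is_vspace V" and W: "is_vspace W" and U: "is_vspace U"
  shows linear_map_tassoc:
      "linear_map (tensor (tensor V W) U) (tensor V (tensor W U)) (tassoc V W U)"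
    and tassoc_sum: "(\<And>i. i \<in> I \<Longrightarrow> a i \<in> carrier V) \<Longrightarrow> (\<And>i. i \<in> I \<Longrightarrow> b i \<in> carrier W) \<Longrightarrow>
      u \<in> carrier U \<Longrightarrow>
      tassoc V W U (tens (tensor V W) U (\<Sum>i\<in>I. tens V W (a i) (b i)) u) =
        (\<Sum>i\<in>I. tens V (tensor W U) (a i) (tens W U (b i) u))"
proof -
  let ?T = "tensor V (tensor W U)"
  let ?b = "\<lambda>u v w. tens V (tensor W U) v (tens W U w u)"
  have T: "is_vspace ?T" by (rule is_vspace_tensor)
  have b: "bilinear_map V W ?T (?b u)" if "u \<in> carrier U" for u
    using that by (auto intro!: bilinear_map_tens_compose linear_map_tens simp: linear_map_def)
  have bil: "bilinear_map (tensor V W) U ?T (\<lambda>t u. lift V W ?T (?b u) t)"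
    unfolding bilinear_map_def
  proof (intro conjI ballI)
    fix u assume "u \<in> carrier U"
    thus "linear_map (tensor V W) ?T (lift V W ?T (?b u))"
      by (intro linear_map_lift V W T b)
  next
    fix t assume "t \<in> carrier (tensor V W)"
    thus "linear_map U ?T (\<lambda>u. lift V W ?T (?b u) t)"
      by (intro linear_map_lift_param V W T b U)
        (auto intro!: linear_map_compose[OF linear_map_tens(1) linear_map_tens(1)])
  qed
  thus "linear_map (tensor (tensor V W) U) ?T (tassoc V W U)"
    unfolding tassoc_def by (intro linear_map_lift is_vspace_tensor U)
  assume ab: "\<And>i. i \<in> I \<Longrightarrow> a i \<in> carrier V" "\<And>i. i \<in> I \<Longrightarrow> b i \<in> carrier W" and u: "u \<in> carrier U"
  hence "(\<Sum>i\<in>I. tens V W (a i) (b i)) \<in> carrier (tensor V W)"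
    by (auto intro!: vspace_sum is_vspace_tensor tens_in_tensor)
  hence "tassoc V W U (tens (tensor V W) U (\<Sum>i\<in>I. tens V W (a i) (b i)) u) =
      lift V W ?T (?b u) (\<Sum>i\<in>I. tens V W (a i) (b i))"
    using u bil by (simp add: tassoc_def lift_tens is_vspace_tensor U)
  also have "\<dots> = (\<Sum>i\<in>I. ?b u (a i) (b i))"
    by (rule lift_sum) (use V W T b u ab in auto)
  finally show "tassoc V W U (tens (tensor V W) U (\<Sum>i\<in>I. tens V W (a i) (b i)) u) =
      (\<Sum>i\<in>I. tens V (tensor W U) (a i) (tens W U (b i) u))" .
qed

text \<open>Shorten an expansion \<open>t = \<Sum> a\<^sub>i \<otimes> b\<^sub>i\<close>: a functional \<open>p\<close> with \<open>p a\<^sub>n \<noteq> 0\<close> and \<open>(p \<otimes> id) t = 0\<close>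
  expresses \<open>b\<^sub>n\<close> through the remaining \<open>b\<^sub>i\<close>.\<close>

lemma tensor_sum_eq_zero:
  fixes V :: "('k::field, 'v::ab_group_add, 'x) vspace_scheme"
    and W :: "('k, 'w::ab_group_add, 'y) vspace_scheme" and n :: nat
  assumes V: "is_vspace V" and W: "is_vspace W"
    and P: "\<And>p. p \<in> P \<Longrightarrow> linear_map V base p"
    and sep: "\<And>x. x \<in> carrier V \<Longrightarrow> (\<And>p. p \<in> P \<Longrightarrow> p x = 0) \<Longrightarrow> x = 0"
    and "\<And>i. a i \<in> carrier V" "\<And>i. b i \<in> carrier W"
    and "\<And>p. p \<in> P \<Longrightarrow> (\<Sum>i<n. smult W (p (a i)) (b i)) = 0"
  shows "(\<Sum>i<n. tens V W (a i) (b i)) = 0"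
  using assms(5-)
proof (induction n arbitrary: a)
  case (Suc n)
  interpret V: vector_space "smult V" using V by (rule vspace_vector_space)
  interpret W: vector_space "smult W" using W by (rule vspace_vector_space)
  show ?case
  proof (cases "a n = 0")
    case True
    have "(\<Sum>i<n. tens V W (a i) (b i)) = 0"
    proof (rule Suc.IH)
      fix p assume p: "p \<in> P"
      show "(\<Sum>i<n. smult W (p (a i)) (b i)) = 0"
        using Suc.prems(3)[OF p] True linear_map_zero[OF V P[OF p]] by simp
    qed (use Suc.prems in auto)
    thus ?thesis using True by simp
  next
    case False
    then obtain p0 where p0: "p0 \<in> P" "p0 (a n) \<noteq> 0" using sep Suc.prems(1) by blast
    \<comment> \<open>Applying \<open>p0\<close> \<otimes> id to the vanishing sum and dividing by
      \<open>p0 (a n)\<close> gives b_n = \<Sum> c_i b_i. Then a_n \<otimes> b_n = \<Sum> (c_i a_n)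
      \<otimes> b_i merges into the other terms, which replaces each a_i by a_i + c_i a_n and
      shortens the sum by one.\<close>
    define c where "c i = - (p0 (a i) / p0 (a n))" for i
    define a' where "a' i = a i + smult V (c i) (a n)" for i
    have "smult W (inverse (p0 (a n))) (\<Sum>i<Suc n. smult W (p0 (a i)) (b i)) = 0"
      using Suc.prems(3)[OF p0(1)] by (metis W.scale_zero_right)
    hence "(\<Sum>i<n. smult W (inverse (p0 (a n)) * p0 (a i)) (b i)) + b n = 0"
      using p0(2) by (simp add: W.scale_right_distrib W.scale_sum_right)
    hence bn: "b n = (\<Sum>i<n. smult W (c i) (b i))"
      unfolding c_def by (simp add: add_eq_0_iff W.scale_minus_left sum_negf field_simps)
    have "(\<Sum>i<n. tens V W (a' i) (b i)) = 0"
    proof (rule Suc.IH)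
      fix p assume p: "p \<in> P"
      have "p (a' i) = p (a i) + c i * p (a n)" for i
        using P[OF p] Suc.prems(1) V
        by (simp add: a'_def linear_map_add linear_map_scale vspace_closed)
      hence "(\<Sum>i<n. smult W (p (a' i)) (b i)) =
          (\<Sum>i<n. smult W (p (a i)) (b i)) + smult W (p (a n)) (b n)"
        by (simp add: bn W.scale_left_distrib W.scale_sum_right sum.distrib mult.commute)
      thus "(\<Sum>i<n. smult W (p (a' i)) (b i)) = 0" using Suc.prems(3)[OF p] by simp
    qed (use Suc.prems V in \<open>auto simp: a'_def vspace_closed\<close>)
    moreover have "tens V W (a n) (b n) = (\<Sum>i<n. tens V W (smult V (c i) (a n)) (b i))"
      by (subst bn) (simp add: tens_sum_right tens_scale_right tens_scale_left)
    ultimately show ?thesis by (simp add: a'_def tens_add_left sum.distrib)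
  qed
qed simp

text \<open>For fixed p, every q in Q sends (p \<otimes> id) t to (p \<otimes> q) t = 0; since Q
  separates points, (p \<otimes> id) t = 0, and \<open>tensor_sum_eq_zero\<close> finishes. Allowing
  arbitrary separating families instead of full duals makes room for point evaluations on spaces of
  functionals.\<close>

lemma tensor_separation:
  fixes V :: "('k::field, 'v::ab_group_add, 'x) vspace_scheme"
    and W :: "('k, 'w::ab_group_add, 'y) vspace_scheme"
  assumes V: "is_vspace V" and W: "is_vspace W"
    and P: "\<And>p. p \<in> P \<Longrightarrow> linear_map V base p"
    and Q: "\<And>q. q \<in> Q \<Longrightarrow> linear_map W base q"
    and sepP: "\<And>x. x \<in> carrier V \<Longrightarrow> (\<And>p. p \<in> P \<Longrightarrow> p x = 0) \<Longrightarrow> x = 0"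
    and sepQ: "\<And>y. y \<in> carrier W \<Longrightarrow> (\<And>q. q \<in> Q \<Longrightarrow> q y = 0) \<Longrightarrow> y = 0"
    and t: "t \<in> carrier (tensor V W)"
    and eq: "\<And>p q. p \<in> P \<Longrightarrow> q \<in> Q \<Longrightarrow> lift V W base (\<lambda>x y. p x * q y) t = 0"
  shows "t = 0"
proof -
  obtain a b and n :: nat where ab: "\<And>i. a i \<in> carrier V" "\<And>i. b i \<in> carrier W"
    and t: "t = (\<Sum>i<n. tens V W (a i) (b i))"
    by (rule tensor_expand[OF V W t]) (rule that)
  have z: "(\<Sum>i<n. smult W (p (a i)) (b i)) = 0" if p: "p \<in> P" for p
  proof (rule sepQ)
    show "(\<Sum>i<n. smult W (p (a i)) (b i)) \<in> carrier W"
      using ab W by (intro vspace_sum vspace_scale)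
    fix q assume q: "q \<in> Q"
    have "q (\<Sum>i<n. smult W (p (a i)) (b i)) = (\<Sum>i<n. p (a i) * q (b i))"
      using ab W Q[OF q] by (simp add: linear_map_sum linear_map_scale vspace_closed)
    also have "\<dots> = lift V W base (\<lambda>x y. p x * q y) t"
      unfolding t by (rule lift_sum[symmetric])
        (use V W ab P[OF p] Q[OF q] in \<open>auto intro: is_vspace_base bilinear_map_mult\<close>)
    finally show "q (\<Sum>i<n. smult W (p (a i)) (b i)) = 0" using eq[OF p q] by simp
  qed
  show ?thesis unfolding t
    by (rule tensor_sum_eq_zero[where P = P, OF V W P sepP]) (assumption | rule ab z | blast)+
qed

section \<open>A common description of the two categories\<close>

text \<open>Just enough structure for testing multiplicativity on pure tensors and unit preservation
  at 1; \<open>ground\<close> and \<open>tensor_struct A A\<close> acquire it from linearity of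
  their operations.\<close>

definition magma :: "('k::field, 'v::ab_group_add) bistruct \<Rightarrow> bool" where
  "magma A \<longleftrightarrow>
     is_vspace A \<and> linear_map (tensor A A) A (mul A) \<and> linear_map base A (unit A)"

lemma unit_eq_scale:
  assumes "linear_map base A (unit A)"
  shows "unit A r = smult A r (unit A 1)"
  using linear_map_scale[OF assms, of 1 r] by simp

text \<open>Both sides of the multiplicativity equation are linear in the tensor, so pure tensors
  decide it; the unit map is determined by its value at 1.\<close>

lemma algebra_map_iff:
  assumes A: "magma A" and B: "magma B"
  shows "algebra_map A B f \<longleftrightarrow> linear_map A B f \<and>
    (\<forall>x\<in>carrier A. \<forall>y\<in>carrier A. f (mul A (tens A A x y)) = mul B (tens B B (f x) (f y))) \<and>
    f (unit A 1) = unit B 1" (is "_ \<longleftrightarrow> _ \<and> ?P \<and> ?Q")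
proof (cases "linear_map A B f")
  case f: True
  have VA: "is_vspace A" and VB: "is_vspace B" and m: "linear_map (tensor A A) A (mul A)"
    "linear_map (tensor B B) B (mul B)" and u: "linear_map base A (unit A)" "linear_map base B (unit B)"
    using A B by (auto simp: magma_def)
  have "(\<forall>t\<in>carrier (tensor A A). f (mul A t) = mul B (tmap A A B B f f t)) \<longleftrightarrow> ?P"
  proof (intro iffI ballI)
    fix t assume ?P and t: "t \<in> carrier (tensor A A)"
    show "f (mul A t) = mul B (tmap A A B B f f t)"
      by (rule linear_map_tensor_eq[OF VA VA linear_map_compose[OF m(1) f]
            linear_map_compose[OF linear_map_tmap[OF VA VA f f] m(2)] _ t])
        (use \<open>?P\<close> in \<open>simp add: tmap_tens VA f\<close>)
  qed (simp add: tens_in_tensor tmap_tens VA f)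
  moreover have "f (unit A r) = unit B r" if ?Q for r
  proof -
    have "unit A 1 \<in> carrier A" using linear_map_closed[OF u(1)] by simp
    thus ?thesis
      using that linear_map_scale[OF f] unit_eq_scale[OF u(1)] unit_eq_scale[OF u(2)] by metis
  qed
  ultimately show ?thesis using f unfolding algebra_map_def by blast
qed (simp add: algebra_map_def)

text \<open>The product of A \<otimes> A is the interchange followed by m \<otimes> m. Sums are kept
  in both arguments in order to multiply two coproducts directly.\<close>

lemma
  assumes "is_vspace A" and m: "linear_map (tensor A A) A (mul A)"
  shows linear_map_mul_tensor_struct:
      "linear_map (tensor (tensor A A) (tensor A A)) (tensor A A) (mul (tensor_struct A A))"
    and mul_tensor_struct_sum:
      "(\<And>i. i \<in> I \<Longrightarrow> a i \<in> carrier A) \<Longrightarrow> (\<And>i. i \<in> I \<Longrightarrow> b i \<in> carrier A) \<Longrightarrow>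
       (\<And>j. j \<in> J \<Longrightarrow> c j \<in> carrier A) \<Longrightarrow> (\<And>j. j \<in> J \<Longrightarrow> d j \<in> carrier A) \<Longrightarrow>
       mul (tensor_struct A A) (tens (tensor A A) (tensor A A)
         (\<Sum>i\<in>I. tens A A (a i) (b i)) (\<Sum>j\<in>J. tens A A (c j) (d j))) =
       (\<Sum>i\<in>I. \<Sum>j\<in>J. tens A A (mul A (tens A A (a i) (c j))) (mul A (tens A A (b i) (d j))))"
proof -
  have T: "is_vspace (tensor A A)" by (rule is_vspace_tensor)
  note lin = linear_map_tmap[OF T T m m]
  have eq: "mul (tensor_struct A A) =
      (\<lambda>t. tmap (tensor A A) (tensor A A) A A (mul A) (mul A) (interchange A A A A t))"
    by (simp add: tensor_struct_def)
  show "linear_map (tensor (tensor A A) (tensor A A)) (tensor A A) (mul (tensor_struct A A))"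
    unfolding eq by (rule linear_map_compose[OF linear_map_interchange lin]) (rule assms(1))+
  assume *: "\<And>i. i \<in> I \<Longrightarrow> a i \<in> carrier A" "\<And>i. i \<in> I \<Longrightarrow> b i \<in> carrier A"
    "\<And>j. j \<in> J \<Longrightarrow> c j \<in> carrier A" "\<And>j. j \<in> J \<Longrightarrow> d j \<in> carrier A"
  show "mul (tensor_struct A A) (tens (tensor A A) (tensor A A)
         (\<Sum>i\<in>I. tens A A (a i) (b i)) (\<Sum>j\<in>J. tens A A (c j) (d j))) =
       (\<Sum>i\<in>I. \<Sum>j\<in>J. tens A A (mul A (tens A A (a i) (c j))) (mul A (tens A A (b i) (d j))))"
    using * assms T
    by (simp add: eq interchange_sum linear_map_sum[OF is_vspace_tensor lin] vspace_sum
        is_vspace_tensor tens_in_tensor tmap_tens)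
qed

lemma tensor_struct_simps [simp]:
  "carrier (tensor_struct A B) = carrier (tensor A B)"
  "smult (tensor_struct A B) = fscale"
  "counit (tensor_struct A B) = lift A B base (\<lambda>x y. counit A x * counit B y)"
  "unit (tensor_struct A B) = (\<lambda>r. fscale r (tens A B (unit A 1) (unit B 1)))"
  by (simp_all add: tensor_struct_def)

lemma ground_simps [simp]:
  "carrier ground = UNIV" "smult ground = (*)" "mul ground = lift base base base (*)"
  "unit ground = (\<lambda>r. r)" "counit ground = (\<lambda>r. r)"
  "comul ground = (\<lambda>r. fscale r (tens base base 1 1))"
  by (simp_all add: ground_def)

lemma is_vspace_cong:
  "carrier V = carrier W \<Longrightarrow> smult V = smult W \<Longrightarrow> is_vspace V = is_vspace W"
  by (simp add: is_vspace_def)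

lemma is_vspace_tensor_struct: "is_vspace (tensor_struct A B)"
  using is_vspace_tensor[of A B] is_vspace_cong[of "tensor_struct A B" "tensor A B"] by simp

lemma is_vspace_ground: "is_vspace ground"
  using is_vspace_base by (subst is_vspace_cong[of _ base]) simp_all

lemma linear_map_id_base: "linear_map base base (\<lambda>r. r)"
  by (simp add: linear_map_def)

lemma linear_map_scaled:
  assumes "is_vspace V" "v \<in> carrier V"
  shows "linear_map base V (\<lambda>r. smult V r v)"
proof -
  interpret vector_space "smult V" using assms(1) by (rule vspace_vector_space)
  show ?thesis using assms by (auto simp: linear_map_def vspace_scale scale_left_distrib)
qed

lemma magma_tensor_struct:
  assumes "magma A"
  shows "magma (tensor_struct A A)"
proof -
  have A: "is_vspace A" and m: "linear_map (tensor A A) A (mul A)" and u: "linear_map base A (unit A)"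
    using assms by (auto simp: magma_def)
  have t: "tensor (tensor_struct A A) (tensor_struct A A) = tensor (tensor A A) (tensor A A)"
    by (rule tensor_cong) simp_all
  have "tens A A (unit A 1) (unit A 1) \<in> carrier (tensor A A)"
    using linear_map_closed[OF u, of 1] by (intro tens_in_tensor) simp_all
  from linear_map_scaled[OF is_vspace_tensor this] show ?thesis
    using linear_map_mul_tensor_struct[OF A m]
      linear_map_cong_vspace[of "tensor A A" "tensor_struct A A" ]
    unfolding magma_def t by (auto simp: is_vspace_tensor_struct linear_map_def)
qed

lemma lift_base_mult: "lift base base base (*) (tens base base x y) = x * y"
  using lift_tens[OF is_vspace_base is_vspace_base is_vspace_base
      bilinear_map_mult[OF linear_map_id_base linear_map_id_base]] by simp

lemma mul_ground: "mul ground (tens ground ground x y) = x * (y :: 'k::field)"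
proof -
  have "tens ground ground = tens base (base :: ('k, 'k) vspace)" by (rule tens_cong) simp_all
  thus ?thesis by (simp add: lift_base_mult)
qed

lemma magma_ground: "magma ground"
proof -
  have t: "tensor ground ground = tensor base base" by (rule tensor_cong) simp_all
  show ?thesis
    using linear_map_lift[OF is_vspace_base is_vspace_base is_vspace_base
      bilinear_map_mult[OF linear_map_id_base linear_map_id_base]]
    unfolding magma_def t by (auto simp: is_vspace_ground linear_map_def)
qed

text \<open>The structure common to both categories, with the compatibility of product and coproduct
  tested on elements only; it treats the algebra and the coalgebra side symmetrically.\<close>

definition bialgebra :: "('k::field, 'v::ab_group_add) bistruct \<Rightarrow> bool" where
  "bialgebra A \<longleftrightarrow> nonassoc_algebra A \<and> noncoassoc_coalgebra A \<and>
     comul A (unit A 1) = tens A A (unit A 1) (unit A 1) \<and> counit A (unit A 1) = 1 \<and>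
     (\<forall>x\<in>carrier A. \<forall>y\<in>carrier A.
        counit A (mul A (tens A A x y)) = counit A x * counit A y \<and>
        comul A (mul A (tens A A x y)) =
          mul (tensor_struct A A) (tens (tensor A A) (tensor A A) (comul A x) (comul A y)))"

lemma nonassoc_algebraD:
  assumes "nonassoc_algebra A"
  shows "is_vspace A" "linear_map (tensor A A) A (mul A)" "linear_map base A (unit A)"
    "unit A r \<in> carrier A" "magma A"
    "x \<in> carrier A \<Longrightarrow> mul A (tens A A (unit A 1) x) = x"
    "x \<in> carrier A \<Longrightarrow> mul A (tens A A x (unit A 1)) = x"
    "x \<in> carrier A \<Longrightarrow> y \<in> carrier A \<Longrightarrow> mul A (tens A A x y) \<in> carrier A"
  using assms linear_map_closed[of base A "unit A"] linear_map_closed[of "tensor A A" A "mul A"]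
  by (auto simp: nonassoc_algebra_def magma_def tens_in_tensor)

lemma noncoassoc_coalgebraD:
  assumes "noncoassoc_coalgebra C"
  shows "is_vspace C" "linear_map C (tensor C C) (comul C)" "linear_map C base (counit C)"
    "x \<in> carrier C \<Longrightarrow> comul C x \<in> carrier (tensor C C)"
  using assms linear_map_closed[of C "tensor C C" "comul C"] by (auto simp: noncoassoc_coalgebra_def)

text \<open>\<open>algebra_map_iff\<close> turns the conditions on \<Delta> and \<epsilon> into
  equations on elements, once \<open>tensor_struct A A\<close> and \<open>ground\<close> are
  identified with \<open>tensor A A\<close> and \<open>base\<close> in carrier and scalars.\<close>

lemma NCoalg_Alg_iff: "NCoalg_Alg A \<longleftrightarrow> bialgebra A \<and> associative A"
proof (cases "nonassoc_algebra A \<and> noncoassoc_coalgebra A")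
  case True
  hence A: "nonassoc_algebra A" and C: "noncoassoc_coalgebra A" by auto
  note a = nonassoc_algebraD[OF A] and c = noncoassoc_coalgebraD[OF C]
  have t: "tens (tensor_struct A A) (tensor_struct A A) = tens (tensor A A) (tensor A A)"
    by (rule tens_cong) simp_all
  have "linear_map A (tensor_struct A A) = linear_map A (tensor A A)"
    "linear_map A ground = linear_map A base"
    by (rule linear_map_cong_vspace; simp)+
  hence "algebra_map A (tensor_struct A A) (comul A) \<longleftrightarrow>
      (\<forall>x\<in>carrier A. \<forall>y\<in>carrier A. comul A (mul A (tens A A x y)) =
          mul (tensor_struct A A) (tens (tensor A A) (tensor A A) (comul A x) (comul A y))) \<and>
      comul A (unit A 1) = tens A A (unit A 1) (unit A 1)"
    and "algebra_map A ground (counit A) \<longleftrightarrow>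
      (\<forall>x\<in>carrier A. \<forall>y\<in>carrier A. counit A (mul A (tens A A x y)) = counit A x * counit A y) \<and>
      counit A (unit A 1) = 1"
    using c by (simp_all add: algebra_map_iff a(5) magma_tensor_struct magma_ground t mul_ground
        del: ground_simps(3)) (simp_all add: fscale_def)
  thus ?thesis using True by (auto simp: NCoalg_Alg_def bialgebra_def)
qed (auto simp: NCoalg_Alg_def bialgebra_def)

text \<open>The conditions that m and u are coalgebra maps unfold to the same element equations that
  \<open>NCoalg_Alg_iff\<close> obtains from \<Delta> and \<epsilon>.\<close>

lemma NAlg_Coalg_iff: "NAlg_Coalg A \<longleftrightarrow> bialgebra A \<and> coassociative A"
proof (cases "nonassoc_algebra A \<and> noncoassoc_coalgebra A")
  case True
  hence A: "nonassoc_algebra A" and C: "noncoassoc_coalgebra A" by auto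
  note a = nonassoc_algebraD[OF A] and c = noncoassoc_coalgebraD[OF C]
  let ?T = "tensor A A"
  have lin: "linear_map (tensor_struct A A) A = linear_map ?T A"
    "linear_map ground A = linear_map base A"
    by (rule linear_map_cong_vspace; simp)+
  have tmap: "tmap (tensor_struct A A) (tensor_struct A A) A A = tmap ?T ?T A A"
    "tmap ground ground A A = tmap base base A A"
    by (rule tmap_cong; simp)+
  \<comment> \<open>With equal factors, the interchange in the coproduct of
    \<open>tensor_struct A A\<close> is the one in its product. Hence m \<otimes> m after the former
    equals the product of A \<otimes> A after \<Delta> \<otimes> \<Delta>.\<close>
  have comul: "tmap ?T ?T A A (mul A) (mul A) (comul (tensor_struct A A) t) =
      mul (tensor_struct A A) (tmap A A ?T ?T (comul A) (comul A) t)" for t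
    by (simp add: tensor_struct_def)
  have "(\<forall>t\<in>carrier ?T. comul A (mul A t) =
        mul (tensor_struct A A) (tmap A A ?T ?T (comul A) (comul A) t)) \<longleftrightarrow>
      (\<forall>x\<in>carrier A. \<forall>y\<in>carrier A. comul A (mul A (tens A A x y)) =
        mul (tensor_struct A A) (tens ?T ?T (comul A x) (comul A y)))" (is "_ \<longleftrightarrow> ?P")
  proof (intro iffI ballI)
    fix t assume ?P and t: "t \<in> carrier ?T"
    show "comul A (mul A t) = mul (tensor_struct A A) (tmap A A ?T ?T (comul A) (comul A) t)"
      by (rule linear_map_tensor_eq[OF a(1) a(1) linear_map_compose[OF a(2) c(2)]
          linear_map_compose[OF linear_map_tmap[OF a(1) a(1) c(2) c(2)]
            linear_map_mul_tensor_struct[OF a(1,2)]] _ t])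
        (use \<open>?P\<close> in \<open>simp add: tmap_tens a c\<close>)
  qed (simp add: tens_in_tensor tmap_tens a c)
  moreover have "(\<forall>t\<in>carrier ?T. counit A (mul A t) =
        lift A A base (\<lambda>x y. counit A x * counit A y) t) \<longleftrightarrow>
      (\<forall>x\<in>carrier A. \<forall>y\<in>carrier A. counit A (mul A (tens A A x y)) = counit A x * counit A y)"
    (is "_ \<longleftrightarrow> ?Q")
  proof (intro iffI ballI)
    fix t assume ?Q and t: "t \<in> carrier ?T"
    show "counit A (mul A t) = lift A A base (\<lambda>x y. counit A x * counit A y) t"
      by (rule linear_map_tensor_eq[OF a(1) a(1) linear_map_compose[OF a(2) c(3)]
          linear_map_lift[OF a(1) a(1) is_vspace_base bilinear_map_mult[OF c(3) c(3)]] _ t])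
        (use \<open>?Q\<close> in \<open>simp add: lift_tens a c is_vspace_base bilinear_map_mult\<close>)
  qed (simp add: tens_in_tensor lift_tens a c is_vspace_base bilinear_map_mult)
  ultimately have mul: "coalgebra_map (tensor_struct A A) A (mul A) \<longleftrightarrow> ?P \<and> ?Q"
    using a(2) by (auto simp: coalgebra_map_def lin tmap comul)
  \<comment> \<open>All maps involved are linear, so the coalgebra conditions on the unit map at r
    are r times those at 1.\<close>
  have "tmap base base A A (unit A) (unit A) (fscale r (tens base base 1 1)) =
      fscale r (tens A A (unit A 1) (unit A 1))" for r
    using linear_map_scale[OF linear_map_tmap[OF is_vspace_base is_vspace_base a(3) a(3)],
        of "tens base base 1 1" r]
    by (simp add: tens_in_tensor tmap_tens is_vspace_base a)
  moreover have "comul A (unit A r) = fscale r (comul A (unit A 1))"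
    "counit A (unit A r) = r * counit A (unit A 1)" for r
    using linear_map_scale[OF c(2) a(4)[of 1], of r] linear_map_scale[OF c(3) a(4)[of 1], of r]
    unfolding unit_eq_scale[OF a(3), of r] by simp_all
  moreover have "fscale 1 t = t" for t :: "('a, 'b, 'b) tensor" by (simp add: fscale_def)
  ultimately have "coalgebra_map ground A (unit A) \<longleftrightarrow>
      comul A (unit A 1) = tens A A (unit A 1) (unit A 1) \<and> counit A (unit A 1) = 1"
    unfolding coalgebra_map_def lin tmap ground_simps using a(3) by (metis UNIV_I mult.right_neutral)
  with mul show ?thesis using True by (auto simp: NAlg_Coalg_def bialgebra_def)
qed (auto simp: NAlg_Coalg_def bialgebra_def)

section \<open>The canonical injection and good subspaces\<close>

text \<open>Functionals in the dual vanish off the carrier, so an equation between them, read as an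
  equation of functions, needs checking only at points of \<open>carrier U\<close>.\<close>

lemma linear_map_into_dual:
  assumes "\<And>x. x \<in> carrier X \<Longrightarrow> h x \<in> Lin U base" "is_vspace X"
    and "\<And>t. t \<in> carrier U \<Longrightarrow> linear_map X base (\<lambda>x. h x t)"
  shows "linear_map X (dual U) h"
  unfolding linear_map_def smult_dual carrier_dual
proof (intro conjI ballI allI)
  have zero: "h x t = 0" if "x \<in> carrier X" "t \<notin> carrier U" for x t
    using assms(1)[OF that(1)] that(2) by (rule LinD(2))
  fix x y r assume x: "x \<in> carrier X" and y: "y \<in> carrier X"
  show "h (x + y) = h x + h y"
  proof
    fix t show "h (x + y) t = (h x + h y) t"
      using assms(2,3) x y zero by (cases "t \<in> carrier U") (auto simp: linear_map_def vspace_closed)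
  qed
next
  have zero: "h x t = 0" if "x \<in> carrier X" "t \<notin> carrier U" for x t
    using assms(1)[OF that(1)] that(2) by (rule LinD(2))
  fix x r assume x: "x \<in> carrier X"
  show "h (smult X r x) = fscale r (h x)"
  proof
    fix t show "h (smult X r x) t = fscale r (h x) t"
      using assms(2,3) x zero by (cases "t \<in> carrier U") (auto simp: linear_map_def vspace_closed)
  qed
qed (use assms in auto)

lemma linear_map_apply:
  assumes "smult X = fscale"
  shows "linear_map X base (\<lambda>f. f v)"
  using assms by (auto simp: linear_map_def)

lemma bilinear_map_phi:
  assumes V: "is_vspace V" and W: "is_vspace W"
  shows "bilinear_map (dual V) (dual W) (dual (tensor V W)) (\<lambda>f g. lift V W base (\<lambda>v w. f v * g w))"
proof -
  have b: "bilinear_map V W base (\<lambda>v w. f v * g w)" if "f \<in> Lin V base" "g \<in> Lin W base" for f g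
    using that by (intro bilinear_map_mult LinD)
  have "linear_map (dual V) (dual (tensor V W)) (\<lambda>f. lift V W base (\<lambda>v w. f v * g w))"
    if "g \<in> Lin W base" for g
    by (intro linear_map_into_dual lift_in_Lin linear_map_lift_param V W is_vspace_base b
        is_vspace_dual linear_map_mult linear_map_apply; use that in \<open>simp add: carrier_dual\<close>)
  moreover have "linear_map (dual W) (dual (tensor V W)) (\<lambda>g. lift V W base (\<lambda>v w. f v * g w))"
    if "f \<in> Lin V base" for f
    by (intro linear_map_into_dual lift_in_Lin linear_map_lift_param V W is_vspace_base b
        is_vspace_dual linear_map_mult linear_map_apply; use that in \<open>simp add: carrier_dual\<close>)
  ultimately show ?thesis by (simp add: bilinear_map_def carrier_dual)
qed

lemma linear_map_phi:
  assumes "is_vspace V" "is_vspace W"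
  shows "linear_map (tensor (dual V) (dual W)) (dual (tensor V W)) (phi V W)"
  unfolding phi_def
  by (intro linear_map_lift is_vspace_dual is_vspace_tensor bilinear_map_phi assms)

lemma phi_tens:
  assumes "is_vspace V" "is_vspace W" "f \<in> Lin V base" "g \<in> Lin W base"
    and XY: "smult X = fscale" "smult Y = fscale"
  shows "phi V W (tens X Y f g) = lift V W base (\<lambda>v w. f v * g w)"
proof -
  have t: "tens X Y = tens (dual V) (dual W)" by (rule tens_cong) (simp_all add: XY)
  show ?thesis
    unfolding phi_def t
    by (rule lift_tens)
      (simp_all add: assms is_vspace_dual is_vspace_tensor bilinear_map_phi carrier_dual)
qed

lemma phi_sum_tens:
  assumes V: "is_vspace V" and W: "is_vspace W"
    and fg: "\<And>i. i \<in> I \<Longrightarrow> f i \<in> Lin V base" "\<And>i. i \<in> I \<Longrightarrow> g i \<in> Lin W base"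
    and v: "v \<in> carrier V" and w: "w \<in> carrier W" and XY: "smult X = fscale" "smult Y = fscale"
  shows "phi V W (\<Sum>i\<in>I. tens X Y (f i) (g i)) (tens V W v w) = (\<Sum>i\<in>I. f i v * g i w)"
proof -
  have t: "tens X Y = tens (dual V) (dual W)" by (rule tens_cong) (simp_all add: XY)
  have "phi V W (\<Sum>i\<in>I. tens X Y (f i) (g i)) = (\<Sum>i\<in>I. phi V W (tens X Y (f i) (g i)))"
    unfolding t by (rule linear_map_sum[OF is_vspace_tensor linear_map_phi[OF V W]])
      (simp add: tens_in_tensor carrier_dual fg)
  moreover have "phi V W (tens X Y (f i) (g i)) (tens V W v w) = f i v * g i w" if "i \<in> I" for i
    using that fg[THEN LinD(1)] v w
    by (simp add: phi_tens[OF V W _ _ XY] fg lift_tens V W is_vspace_base bilinear_map_mult)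
  ultimately show ?thesis by (simp add: sum_fun_apply)
qed

lemma phi_double_sum_tens:
  assumes "is_vspace V" "is_vspace W"
    and "\<And>i j. i \<in> I \<Longrightarrow> j \<in> J \<Longrightarrow> f i j \<in> Lin V base"
    and "\<And>i j. i \<in> I \<Longrightarrow> j \<in> J \<Longrightarrow> g i j \<in> Lin W base"
    and "v \<in> carrier V" "w \<in> carrier W" "smult X = fscale" "smult Y = fscale"
  shows "phi V W (\<Sum>i\<in>I. \<Sum>j\<in>J. tens X Y (f i j) (g i j)) (tens V W v w) =
    (\<Sum>i\<in>I. \<Sum>j\<in>J. f i j v * g i j w)"
  unfolding sum.cartesian_product case_prod_unfold
  by (rule phi_sum_tens) (use assms in auto)

text \<open>Evaluating \<phi> t at v \<otimes> w amounts to applying ev_v \<otimes> ev_w to t. This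
  ties \<phi> to \<open>tensor_separation\<close>; stating it for subspaces of the duals covers
  \<open>bullet A\<close>.\<close>

lemma phi_tens_eq_lift:
  assumes V: "is_vspace V" and W: "is_vspace W" and X: "is_vspace X" and Y: "is_vspace Y"
    and sub: "carrier X \<subseteq> Lin V base" "carrier Y \<subseteq> Lin W base"
    and s: "smult X = fscale" "smult Y = fscale"
    and v: "v \<in> carrier V" and w: "w \<in> carrier W" and t: "t \<in> carrier (tensor X Y)"
  shows "phi V W t (tens V W v w) = lift X Y base (\<lambda>f g. f v * g w) t"
proof -
  obtain f g and n :: nat where fg: "\<And>i. f i \<in> carrier X" "\<And>i. g i \<in> carrier Y"
    and tn: "t = (\<Sum>i<n. tens X Y (f i) (g i))"
    by (rule tensor_expand[OF X Y t]) (rule that)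
  have "phi V W t (tens V W v w) = (\<Sum>i<n. f i v * g i w)"
    unfolding tn by (rule phi_sum_tens[OF V W _ _ v w s]) (use sub fg in blast)+
  moreover have "lift X Y base (\<lambda>f g. f v * g w) t = (\<Sum>i<n. f i v * g i w)"
    unfolding tn by (rule lift_sum[OF X Y is_vspace_base])
      (intro bilinear_map_mult linear_map_apply s fg)+
  ultimately show ?thesis by simp
qed

text \<open>Point evaluations separate normalised functionals, so by
  \<open>tensor_separation\<close> the products ev_v \<otimes> ev_w separate tensors over the duals;
  by \<open>phi_tens_eq_lift\<close> these products are the values of \<phi>.\<close>

lemma phi_inj:
  fixes V :: "('k::field, 'v::ab_group_add, 'x) vspace_scheme"
    and W :: "('k, 'w::ab_group_add, 'y) vspace_scheme"
  assumes V: "is_vspace V" and W: "is_vspace W"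
    and s: "s \<in> carrier (tensor (dual V) (dual W))" and t: "t \<in> carrier (tensor (dual V) (dual W))"
    and eq: "\<And>v w. v \<in> carrier V \<Longrightarrow> w \<in> carrier W \<Longrightarrow> phi V W s (tens V W v w) = phi V W t (tens V W v w)"
  shows "s = t"
proof -
  note D = is_vspace_dual[OF V] is_vspace_dual[OF W]
  have "s - t = 0"
  proof (rule tensor_separation[OF D, where P = "{\<lambda>f. f v | v. v \<in> carrier V}"
        and Q = "{\<lambda>f. f w | w. w \<in> carrier W}"])
    show "s - t \<in> carrier (tensor (dual V) (dual W))"
      by (rule vspace_diff[OF is_vspace_tensor s t])
    fix p :: "('v \<Rightarrow> 'k) \<Rightarrow> 'k" and q :: "('w \<Rightarrow> 'k) \<Rightarrow> 'k"
    assume "p \<in> {\<lambda>f. f v | v. v \<in> carrier V}" "q \<in> {\<lambda>f. f w | w. w \<in> carrier W}"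
    then obtain v w where pq: "p = (\<lambda>f. f v)" "v \<in> carrier V" "q = (\<lambda>f. f w)" "w \<in> carrier W" by auto
    have "lift (dual V) (dual W) base (\<lambda>f g. f v * g w) (s - t) = phi V W (s - t) (tens V W v w)"
      by (rule phi_tens_eq_lift[OF V W D _ _ _ _ pq(2,4), symmetric])
        (simp_all add: carrier_dual vspace_diff[OF is_vspace_tensor s t])
    also have "\<dots> = 0"
    proof -
      have "s = (s - t) + t" by simp
      hence "phi V W s = phi V W (s - t) + phi V W t"
        using linear_map_add[OF linear_map_phi[OF V W] vspace_diff[OF is_vspace_tensor s t] t] by simp
      thus ?thesis using eq[OF pq(2,4)] by simp
    qed
    finally show "lift (dual V) (dual W) base (\<lambda>f g. p f * q g) (s - t) = 0" using pq by simp
  next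
    fix f assume "f \<in> carrier (dual V)" "\<And>p. p \<in> {\<lambda>f. f v | v. v \<in> carrier V} \<Longrightarrow> p f = 0"
    hence "f x = 0" for x by (cases "x \<in> carrier V") (auto simp: carrier_dual LinD(2))
    thus "f = 0" by (simp add: fun_eq_iff)
  next
    fix f assume "f \<in> carrier (dual W)" "\<And>q. q \<in> {\<lambda>f. f w | w. w \<in> carrier W} \<Longrightarrow> q f = 0"
    hence "f x = 0" for x by (cases "x \<in> carrier W") (auto simp: carrier_dual LinD(2))
    thus "f = 0" by (simp add: fun_eq_iff)
  qed (use linear_map_apply[OF smult_dual] in blast)+
  thus ?thesis by simp
qed

section \<open>The largest good subspace and its coproduct\<close>

lemma bullet_simps [simp]:
  "carrier (bullet A) = carrier (bullet_space A)"
  "smult (bullet A) = fscale"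
  "unit (bullet A) = (\<lambda>r. fscale r (transpose_map A (counit A) (\<lambda>s. s)))"
  "counit (bullet A) = (\<lambda>f. f (unit A 1))"
  by (simp_all add: bullet_def)

lemma smult_bullet_space [simp]: "smult (bullet_space A) = fscale"
  by (simp add: bullet_space_def)

lemma is_vspace_bullet: "is_vspace (bullet (A :: ('k::field, 'v::ab_group_add) bistruct))"
proof -
  interpret vector_space "fscale :: 'k \<Rightarrow> ('v \<Rightarrow> 'k) \<Rightarrow> _" by (rule vector_space_fscale)
  show ?thesis by (simp add: is_vspace_def vector_space_axioms bullet_space_def)
qed

lemma carrier_bullet_subset:
  fixes A :: "('k::field, 'v::ab_group_add) bistruct"
  assumes "is_vspace A"
  shows "carrier (bullet A) \<subseteq> Lin A base"
proof -
  interpret vector_space "fscale :: 'k \<Rightarrow> ('v \<Rightarrow> 'k) \<Rightarrow> _" by (rule vector_space_fscale)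
  have "subspace (Lin A base)"
    using is_vspace_dual[OF assms] by (simp add: is_vspace_def carrier_dual)
  thus ?thesis
    unfolding bullet_simps bullet_space_def vspace.simps
    by (intro span_minimal) (auto simp: good_def carrier_dual)
qed

lemmas bullet_in_Lin = subsetD[OF carrier_bullet_subset]

lemma tensor_bullet_space: "tensor (bullet_space A) (bullet_space A) = tensor (bullet A) (bullet A)"
  by (rule tensor_cong) simp_all

lemma comul_bullet: "comul (bullet A) f = (THE t. t \<in> carrier (tensor (bullet A) (bullet A)) \<and>
    phi A A t = transpose_map (tensor A A) (mul A) f)"
  unfolding tensor_bullet_space[symmetric] by (simp add: bullet_def)

lemma tensor_bullet_subset:
  assumes "is_vspace A"
  shows "carrier (tensor (bullet A) (bullet A)) \<subseteq> carrier (tensor (dual A) (dual A))"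
  using carrier_bullet_subset[OF assms] by (intro carrier_tensor_mono) (simp_all add: carrier_dual)

lemma transpose_in_Lin:
  assumes "is_vspace V" "linear_map V W f" "h \<in> Lin W base"
  shows "transpose_map V f h \<in> Lin V base"
proof -
  have "linear_map V base (\<lambda>x. h (f x))"
    using assms by (intro linear_map_compose[OF assms(2)] LinD)
  hence "linear_map V base (transpose_map V f h)"
    by (rule linear_map_cong[OF assms(1)]) (simp add: transpose_map_def)
  thus ?thesis by (simp add: Lin_def transpose_map_def)
qed

text \<open>This is the preimage of the subspace \<phi>(S \<otimes> S) under the linear transpose of
  m. It reduces goodness of a span to a check on generators, for the sum of all good subspaces as
  well as for spans of chosen sets.\<close>

lemma subspace_comultipliable:
  fixes A :: "('k::field, 'v::ab_group_add) bistruct"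
  assumes A: "is_vspace A" and S: "carrier S \<subseteq> Lin A base" "smult S = fscale"
  shows "module.subspace fscale {f \<in> Lin A base. transpose_map (tensor A A) (mul A) f
    \<in> phi A A ` carrier (tensor S S)}"
proof -
  interpret vector_space "fscale :: 'k \<Rightarrow> ('v \<Rightarrow> 'k) \<Rightarrow> _" by (rule vector_space_fscale)
  note D = is_vspace_dual[OF A] and T = is_vspace_tensor[of S S]
  have sub: "carrier (tensor S S) \<subseteq> carrier (tensor (dual A) (dual A))"
    by (rule carrier_tensor_mono) (use S in \<open>simp_all add: carrier_dual\<close>)
  note phi = linear_map_phi[OF A A]
  show ?thesis
  proof (rule subspaceI)
    have "transpose_map (tensor A A) (mul A) 0 = phi A A 0"
      by (auto simp: linear_map_zero[OF is_vspace_tensor phi] transpose_map_def fun_eq_iff)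
    thus "0 \<in> {f \<in> Lin A base. transpose_map (tensor A A) (mul A) f \<in> phi A A ` carrier (tensor S S)}"
      using vspace_zero[OF D] vspace_zero[OF T] by (auto simp: carrier_dual)
  next
    fix f g assume "f \<in> {f \<in> Lin A base. transpose_map (tensor A A) (mul A) f \<in> phi A A ` carrier (tensor S S)}"
      "g \<in> {f \<in> Lin A base. transpose_map (tensor A A) (mul A) f \<in> phi A A ` carrier (tensor S S)}"
    then obtain s t where st: "s \<in> carrier (tensor S S)" "t \<in> carrier (tensor S S)"
      "transpose_map (tensor A A) (mul A) f = phi A A s"
      "transpose_map (tensor A A) (mul A) g = phi A A t" and fg: "f \<in> Lin A base" "g \<in> Lin A base"
      by auto
    have "transpose_map (tensor A A) (mul A) (f + g) = phi A A s + phi A A t"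
      by (subst st(3,4)[symmetric])+ (simp add: transpose_map_def fun_eq_iff)
    also have "\<dots> = phi A A (s + t)" using st sub by (intro linear_map_add[OF phi, symmetric]) auto
    finally show "f + g \<in> {f \<in> Lin A base. transpose_map (tensor A A) (mul A) f \<in> phi A A ` carrier (tensor S S)}"
      using vspace_add[OF D, of f g] vspace_add[OF T st(1,2)] fg by (auto simp: carrier_dual)
  next
    fix r f assume "f \<in> {f \<in> Lin A base. transpose_map (tensor A A) (mul A) f \<in> phi A A ` carrier (tensor S S)}"
    then obtain s where st: "s \<in> carrier (tensor S S)"
      "transpose_map (tensor A A) (mul A) f = phi A A s" and f: "f \<in> Lin A base"
      by auto
    have "transpose_map (tensor A A) (mul A) (fscale r f) = fscale r (phi A A s)"
      by (subst st(2)[symmetric]) (simp add: transpose_map_def fun_eq_iff)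
    also have "\<dots> = phi A A (fscale r s)"
      using linear_map_scale[OF phi, of s r] st sub by auto
    finally show "fscale r f \<in> {f \<in> Lin A base. transpose_map (tensor A A) (mul A) f \<in> phi A A ` carrier (tensor S S)}"
      using vspace_scale[OF D, of f r] vspace_scale[OF T st(1)] f by (auto simp: carrier_dual)
  qed
qed

text \<open>The sum of all good subspaces is itself good: for each good S, the tensors over S lie
  among those over \<open>bullet A\<close>, and \<open>subspace_comultipliable\<close> extends the
  condition from the union to its span.\<close>

lemma bullet_ex_comul:
  fixes A :: "('k::field, 'v::ab_group_add) bistruct"
  assumes A: "is_vspace A" and f: "f \<in> carrier (bullet A)"
  shows "\<exists>t \<in> carrier (tensor (bullet A) (bullet A)). phi A A t = transpose_map (tensor A A) (mul A) f"
proof -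
  interpret vector_space "fscale :: 'k \<Rightarrow> ('v \<Rightarrow> 'k) \<Rightarrow> _" by (rule vector_space_fscale)
  let ?X = "{f \<in> Lin A base. transpose_map (tensor A A) (mul A) f
    \<in> phi A A ` carrier (tensor (bullet A) (bullet A))}"
  have "S \<subseteq> ?X" if S: "good A S" for S
  proof
    fix f assume "f \<in> S"
    with S have "f \<in> Lin A base" "transpose_map (tensor A A) (mul A) f
        \<in> phi A A ` carrier (tensor \<lparr>carrier = S, smult = fscale\<rparr> \<lparr>carrier = S, smult = fscale\<rparr>)"
      by (auto simp: good_def carrier_dual Let_def)
    moreover have "S \<subseteq> carrier (bullet A)"
      using S by (auto simp: bullet_space_def intro!: span_base)
    hence "carrier (tensor \<lparr>carrier = S, smult = fscale\<rparr> \<lparr>carrier = S, smult = fscale\<rparr>) \<subseteq>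
        carrier (tensor (bullet A) (bullet A))"
      by (intro carrier_tensor_mono) simp_all
    ultimately show "f \<in> ?X" by auto
  qed
  hence "carrier (bullet A) \<subseteq> ?X"
    using subspace_comultipliable[OF A carrier_bullet_subset[OF A]]
    unfolding bullet_simps(1) bullet_space_def vspace.simps by (intro span_minimal) auto
  with f have "f \<in> ?X" by blast
  thus ?thesis by force
qed

text \<open>The span of \<open>S\<close> is a good subspace: the factors g_i and h_i supply a tensor
  over it that \<phi> sends to the composite of f with m. The index type is left open because single
  sums, double sums and single terms all occur.\<close>

lemma bullet_memI:
  fixes A :: "('k::field, 'v::ab_group_add) bistruct"
  assumes A: "is_vspace A" "linear_map (tensor A A) A (mul A)" and S: "S \<subseteq> Lin A base"
    and ex: "\<And>f. f \<in> S \<Longrightarrow> \<exists>(I::'i set) g h. (\<forall>i\<in>I. g i \<in> S \<and> h i \<in> S) \<and>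
      (\<forall>x\<in>carrier A. \<forall>y\<in>carrier A. f (mul A (tens A A x y)) = (\<Sum>i\<in>I. g i x * h i y))"
    and f: "f \<in> S"
  shows "f \<in> carrier (bullet A)"
proof -
  interpret vector_space "fscale :: 'k \<Rightarrow> ('v \<Rightarrow> 'k) \<Rightarrow> _" by (rule vector_space_fscale)
  define W where "W = \<lparr>carrier = span S, smult = fscale\<rparr>"
  have "subspace (Lin A base)"
    using is_vspace_dual[OF A(1)] by (simp add: is_vspace_def carrier_dual)
  hence W: "carrier W \<subseteq> Lin A base" unfolding W_def vspace.simps by (rule span_minimal[OF S])
  let ?X = "{f \<in> Lin A base. transpose_map (tensor A A) (mul A) f \<in> phi A A ` carrier (tensor W W)}"
  have WX: "span S \<subseteq> ?X"
  proof (rule span_minimal)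
    show "subspace ?X" by (rule subspace_comultipliable[OF A(1) W]) (simp add: W_def)
    show "S \<subseteq> ?X"
    proof
      fix f assume f: "f \<in> S"
      from ex[OF f] obtain I :: "'i set" and g h where *: "\<forall>i\<in>I. g i \<in> S \<and> h i \<in> S"
        "\<forall>x\<in>carrier A. \<forall>y\<in>carrier A. f (mul A (tens A A x y)) = (\<Sum>i\<in>I. g i x * h i y)"
        by (elim exE conjE)
      hence gh: "g i \<in> S" "h i \<in> S" "g i \<in> Lin A base" "h i \<in> Lin A base" if "i \<in> I" for i
        using that S by auto
      let ?t = "\<Sum>i\<in>I. tens W W (g i) (h i)"
      have t: "?t \<in> carrier (tensor W W)"
        by (intro vspace_sum is_vspace_tensor tens_in_tensor) (simp_all add: W_def span_base gh)
      have "carrier (tensor W W) \<subseteq> carrier (tensor (dual A) (dual A))"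
        using W by (intro carrier_tensor_mono) (simp_all add: carrier_dual W_def)
      hence p: "phi A A ?t \<in> Lin (tensor A A) base"
        using t linear_map_closed[OF linear_map_phi[OF A(1) A(1)], of ?t] by (auto simp: carrier_dual)
      have m: "transpose_map (tensor A A) (mul A) f \<in> Lin (tensor A A) base"
        using A f S by (intro transpose_in_Lin is_vspace_tensor) auto
      have "transpose_map (tensor A A) (mul A) f = phi A A ?t"
      proof (rule Lin_tensor_eqI[OF is_vspace_base m p])
        fix x y assume "x \<in> carrier A" "y \<in> carrier A"
        moreover have "phi A A ?t (tens A A x y) = (\<Sum>i\<in>I. g i x * h i y)"
          by (rule phi_sum_tens) (use A \<open>x \<in> _\<close> \<open>y \<in> _\<close> in \<open>simp_all add: W_def gh\<close>)
        ultimately show "transpose_map (tensor A A) (mul A) f (tens A A x y) = phi A A ?t (tens A A x y)"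
          using * by (simp add: transpose_map_def tens_in_tensor)
      qed
      thus "f \<in> ?X" using t f S by auto
    qed
  qed
  hence "good A (span S)"
    unfolding good_def using W by (auto simp: W_def carrier_dual Let_def)
  thus ?thesis using f by (auto simp: bullet_space_def intro!: span_base)
qed

text \<open>The definite description in \<open>comul\<close> is met by \<open>t\<close>, since
  evaluation on pure tensors determines a functional on A \<otimes> A; uniqueness is
  \<open>phi_inj\<close>, applied in the larger space \<open>dual A\<close> \<otimes>
  \<open>dual A\<close>.\<close>

lemma bullet_comul_eqI:
  assumes A: "is_vspace A" "linear_map (tensor A A) A (mul A)" and f: "f \<in> carrier (bullet A)"
    and t: "t \<in> carrier (tensor (bullet A) (bullet A))"
    and eq: "\<And>x y. x \<in> carrier A \<Longrightarrow> y \<in> carrier A \<Longrightarrow>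
      phi A A t (tens A A x y) = f (mul A (tens A A x y))"
  shows "comul (bullet A) f = t"
proof -
  note sub = tensor_bullet_subset[OF A(1)]
  have p: "phi A A t \<in> Lin (tensor A A) base"
    using t sub linear_map_closed[OF linear_map_phi[OF A(1) A(1)], of t] by (auto simp: carrier_dual)
  have m: "transpose_map (tensor A A) (mul A) f \<in> Lin (tensor A A) base"
    by (rule transpose_in_Lin[OF is_vspace_tensor A(2) bullet_in_Lin[OF A(1) f]])
  have *: "phi A A t = transpose_map (tensor A A) (mul A) f"
    by (rule Lin_tensor_eqI[OF is_vspace_base p m]) (simp add: transpose_map_def tens_in_tensor eq)
  have "s = t" if "s \<in> carrier (tensor (bullet A) (bullet A))"
      "phi A A s = transpose_map (tensor A A) (mul A) f" for s
    by (rule phi_inj[OF A(1) A(1) subsetD[OF sub that(1)] subsetD[OF sub t]]) (simp add: that * )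
  hence "(THE t. t \<in> carrier (tensor (bullet A) (bullet A)) \<and>
      phi A A t = transpose_map (tensor A A) (mul A) f) = t"
    by (intro the_equality conjI t * ) blast
  thus ?thesis by (simp add: comul_bullet)
qed

text \<open>Resolves the definite description: existence is \<open>bullet_ex_comul\<close>,
  uniqueness is contained in \<open>bullet_comul_eqI\<close>.\<close>

lemma bullet_comul:
  assumes A: "is_vspace A" "linear_map (tensor A A) A (mul A)" and f: "f \<in> carrier (bullet A)"
  shows "comul (bullet A) f \<in> carrier (tensor (bullet A) (bullet A))"
    and "x \<in> carrier A \<Longrightarrow> y \<in> carrier A \<Longrightarrow>
      lift (bullet A) (bullet A) base (\<lambda>g h. g x * h y) (comul (bullet A) f) = f (mul A (tens A A x y))"
proof -
  note B = is_vspace_bullet[of A]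
  obtain t where t: "t \<in> carrier (tensor (bullet A) (bullet A))"
    and phi: "phi A A t = transpose_map (tensor A A) (mul A) f"
    using bullet_ex_comul[OF A(1) f] by blast
  have c: "comul (bullet A) f = t"
    by (rule bullet_comul_eqI[OF A f t]) (simp add: phi transpose_map_def tens_in_tensor)
  thus "comul (bullet A) f \<in> carrier (tensor (bullet A) (bullet A))" using t by simp
  assume "x \<in> carrier A" "y \<in> carrier A"
  moreover from this
  have "phi A A t (tens A A x y) = lift (bullet A) (bullet A) base (\<lambda>g h. g x * h y) t"
    by (intro phi_tens_eq_lift A B t carrier_bullet_subset bullet_simps)
  ultimately show "lift (bullet A) (bullet A) base (\<lambda>g h. g x * h y) (comul (bullet A) f) =
      f (mul A (tens A A x y))"
    by (simp add: c phi transpose_map_def tens_in_tensor)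
qed

text \<open>Sweedler notation made explicit: one pair of families represents the coproduct as a
  tensor and also computes f(xy).\<close>

lemma bullet_comul_expand:
  assumes A: "is_vspace A" "linear_map (tensor A A) A (mul A)" and f: "f \<in> carrier (bullet A)"
  obtains g h and n :: nat where "\<And>i. g i \<in> carrier (bullet A)" "\<And>i. h i \<in> carrier (bullet A)"
    "comul (bullet A) f = (\<Sum>i<n. tens (bullet A) (bullet A) (g i) (h i))"
    "\<And>x y. x \<in> carrier A \<Longrightarrow> y \<in> carrier A \<Longrightarrow> f (mul A (tens A A x y)) = (\<Sum>i<n. g i x * h i y)"
proof -
  note B = is_vspace_bullet[of A]
  obtain g h and n :: nat where gh: "\<And>i. g i \<in> carrier (bullet A)" "\<And>i. h i \<in> carrier (bullet A)"
    and n: "comul (bullet A) f = (\<Sum>i<n. tens (bullet A) (bullet A) (g i) (h i))"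
    by (rule tensor_expand[OF B B bullet_comul(1)[OF A f]]) (rule that)
  have "f (mul A (tens A A x y)) = (\<Sum>i<n. g i x * h i y)"
    if "x \<in> carrier A" "y \<in> carrier A" for x y
    unfolding bullet_comul(2)[OF A f that, symmetric] n
    by (rule lift_sum[OF B B is_vspace_base])
      (intro bilinear_map_mult linear_map_apply bullet_simps gh)+
  with n show ?thesis by (intro that[OF gh]) auto
qed

section \<open>The dual coalgebra\<close>

text \<open>Both definite descriptions have the same defining predicate. It is used to rewrite the
  map under a lift at elements of the carriers.\<close>

lemma lift_eqI:
  assumes "\<And>v w. v \<in> carrier V \<Longrightarrow> w \<in> carrier W \<Longrightarrow> b v w = b' v w"
  shows "lift V W U b = lift V W U b'"
proof -
  have "(\<lambda>h. h \<in> Lin (tensor V W) U \<and> (\<forall>v\<in>carrier V. \<forall>w\<in>carrier W. h (tens V W v w) = b v w)) =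
      (\<lambda>h. h \<in> Lin (tensor V W) U \<and> (\<forall>v\<in>carrier V. \<forall>w\<in>carrier W. h (tens V W v w) = b' v w))"
    using assms by (intro ext) auto
  thus ?thesis unfolding lift_def by (rule arg_cong)
qed

text \<open>The functional \<open>p \<otimes> (q \<otimes> r)\<close> applied to the two sides of the coassociativity axiom.\<close>

lemma
  fixes C :: "('k::field, 'v::ab_group_add) bistruct"
  assumes C: "is_vspace C" "linear_map C (tensor C C) (comul C)" and x: "x \<in> carrier C"
    and p: "linear_map C base p" and q: "linear_map C base q" and r: "linear_map C base r"
  shows coassoc_left_eval:
    "lift C (tensor C C) base (\<lambda>v t. p v * lift C C base (\<lambda>v w. q v * r w) t)
      (tassoc C C C (tmap C C (tensor C C) C (comul C) (id_map C) (comul C x))) =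
     lift C C base (\<lambda>y z. lift C C base (\<lambda>v w. p v * q w) (comul C y) * r z) (comul C x)"
    and coassoc_right_eval:
    "lift C (tensor C C) base (\<lambda>v t. p v * lift C C base (\<lambda>v w. q v * r w) t)
      (tmap C C C (tensor C C) (id_map C) (comul C) (comul C x)) =
     lift C C base (\<lambda>y z. p y * lift C C base (\<lambda>v w. q v * r w) (comul C z)) (comul C x)"
proof -
  note T = is_vspace_tensor[of C C] and K = is_vspace_base and id = linear_map_id_map[OF C(1)]
  let ?L = "lift C (tensor C C) base (\<lambda>v t. p v * lift C C base (\<lambda>v w. q v * r w) t)"
  obtain a b and n :: nat where ab: "\<And>i. a i \<in> carrier C" "\<And>i. b i \<in> carrier C"
    and n: "comul C x = (\<Sum>i<n. tens C C (a i) (b i))"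
    by (rule tensor_expand[OF C(1) C(1) linear_map_closed[OF C(2) x]]) (rule that)
  have lin: "linear_map (tensor C C) base (lift C C base (\<lambda>v w. f v * g w))"
    if "linear_map C base f" "linear_map C base g" for f g
    by (intro linear_map_lift C K bilinear_map_mult that)
  note bil = bilinear_map_mult[OF p lin[OF q r]]
  note L = linear_map_lift[OF C(1) T K bil]
  \<comment> \<open>The left factor is an arbitrary tensor, because in the next step it is the
    coproduct of a_i, which has to be expanded a second time.\<close>
  have *: "?L (tassoc C C C (tens (tensor C C) C t u)) = lift C C base (\<lambda>v w. p v * q w) t * r u"
    if t: "t \<in> carrier (tensor C C)" and u: "u \<in> carrier C" for t u
  proof -
    obtain c d and m :: nat where cd: "\<And>i. c i \<in> carrier C" "\<And>i. d i \<in> carrier C"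
      and m: "t = (\<Sum>i<m. tens C C (c i) (d i))"
      by (rule tensor_expand[OF C(1) C(1) t]) (rule that)
    have "?L (tassoc C C C (tens (tensor C C) C t u)) =
        (\<Sum>i<m. p (c i) * (q (d i) * r u))"
      using cd u C q r lift_sum[OF C(1) T K bil, of "{..<m}" c "\<lambda>i. tens C C (d i) u"]
      unfolding m by (simp add: tassoc_sum tens_in_tensor lift_tens bilinear_map_mult is_vspace_base)
    moreover have "lift C C base (\<lambda>v w. p v * q w) t = (\<Sum>i<m. p (c i) * q (d i))"
      using cd C p q unfolding m by (simp add: lift_sum bilinear_map_mult is_vspace_base)
    ultimately show ?thesis by (simp add: sum_distrib_right mult.assoc)
  qed
  have "?L (tassoc C C C (tmap C C (tensor C C) C (comul C) (id_map C) (comul C x))) =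
      (\<Sum>i<n. ?L (tassoc C C C (tens (tensor C C) C (comul C (a i)) (b i))))"
    unfolding n using ab C T id linear_map_closed[OF C(2)]
    by (simp add: tmap_sum id_map_def tens_in_tensor
        linear_map_sum[OF is_vspace_tensor linear_map_compose[OF linear_map_tassoc L]])
  also have "\<dots> = (\<Sum>i<n. lift C C base (\<lambda>v w. p v * q w) (comul C (a i)) * r (b i))"
    using * ab linear_map_closed[OF C(2)] by simp
  also have "\<dots> = lift C C base (\<lambda>y z. lift C C base (\<lambda>v w. p v * q w) (comul C y) * r z) (comul C x)"
    unfolding n
    by (rule lift_sum[symmetric])
      (use C ab linear_map_compose[OF C(2) lin[OF p q]] r in \<open>simp_all add: bilinear_map_mult is_vspace_base\<close>)
  finally show "?L (tassoc C C C (tmap C C (tensor C C) C (comul C) (id_map C) (comul C x))) =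
    lift C C base (\<lambda>y z. lift C C base (\<lambda>v w. p v * q w) (comul C y) * r z) (comul C x)" .
  have "?L (tmap C C C (tensor C C) (id_map C) (comul C) (comul C x)) =
      (\<Sum>i<n. p (a i) * lift C C base (\<lambda>v w. q v * r w) (comul C (b i)))"
    using ab C T id linear_map_closed[OF C(2)]
      lift_sum[OF C(1) T K bil, of "{..<n}" a "\<lambda>i. comul C (b i)"]
    unfolding n by (simp add: tmap_sum id_map_def)
  also have "\<dots> = lift C C base (\<lambda>y z. p y * lift C C base (\<lambda>v w. q v * r w) (comul C z)) (comul C x)"
    unfolding n
    by (rule lift_sum[symmetric])
      (use C ab linear_map_compose[OF C(2) lin[OF q r]] p in \<open>simp_all add: bilinear_map_mult is_vspace_base\<close>)
  finally show "?L (tmap C C C (tensor C C) (id_map C) (comul C) (comul C x)) =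
     lift C C base (\<lambda>y z. p y * lift C C base (\<lambda>v w. q v * r w) (comul C z)) (comul C x)" .
qed

lemma counit_expand:
  fixes C :: "('k::field, 'v::ab_group_add) bistruct"
  assumes C: "noncoassoc_coalgebra C" and x: "x \<in> carrier C"
    and ab: "\<And>i. i \<in> I \<Longrightarrow> a i \<in> carrier C" "\<And>i. i \<in> I \<Longrightarrow> b i \<in> carrier C"
    and eq: "comul C x = (\<Sum>i\<in>I. tens C C (a i) (b i))"
  shows "(\<Sum>i\<in>I. smult C (counit C (a i)) (b i)) = x"
    and "(\<Sum>i\<in>I. smult C (counit C (b i)) (a i)) = x"
proof -
  note c = noncoassoc_coalgebraD[OF C]
  interpret vector_space "smult C" using c(1) by (rule vspace_vector_space)
  have "bilinear_map C C C (\<lambda>y z. smult C (counit C y) z)"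
    "bilinear_map C C C (\<lambda>y z. smult C (counit C z) y)"
    using c by (auto simp: bilinear_map_def linear_map_def vspace_closed scale_left_distrib
        scale_right_distrib mult.commute)
  note this[THEN lift_sum[OF c(1) c(1) c(1)], of I a b, OF ab, folded eq]
  moreover have "lift C C C (\<lambda>y z. smult C (counit C y) z) (comul C x) = x"
    "lift C C C (\<lambda>y z. smult C (counit C z) y) (comul C x) = x"
    using C x by (auto simp: noncoassoc_coalgebra_def)
  ultimately show "(\<Sum>i\<in>I. smult C (counit C (a i)) (b i)) = x"
    "(\<Sum>i\<in>I. smult C (counit C (b i)) (a i)) = x"
    by simp_all
qed

text \<open>Linearity of the coproduct follows from its characterisation by evaluation at pairs; the
  counit laws are f(1x) = f(x) = f(x1).\<close>

lemma noncoassoc_coalgebra_bullet: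
  fixes A :: "('k::field, 'v::ab_group_add) bistruct"
  assumes "nonassoc_algebra A"
  shows "noncoassoc_coalgebra (bullet A)"
proof -
  note A = nonassoc_algebraD[OF assms] and B = is_vspace_bullet[of A]
  note comul = bullet_comul[OF A(1,2)]
  let ?T = "tensor (bullet A) (bullet A)"
  let ?e = "\<lambda>x y. lift (bullet A) (bullet A) base (\<lambda>g h. g x * h y)"
  have phi: "phi A A t (tens A A x y) = ?e x y t"
    if "x \<in> carrier A" "y \<in> carrier A" "t \<in> carrier ?T" for x y t
    using that by (intro phi_tens_eq_lift A B carrier_bullet_subset bullet_simps)
  have e: "linear_map ?T base (?e x y)" for x y
    by (intro linear_map_lift B is_vspace_base bilinear_map_mult linear_map_apply bullet_simps)
  have "linear_map (bullet A) ?T (comul (bullet A))"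
    unfolding linear_map_def
  proof (intro conjI ballI allI)
    fix f g assume f: "f \<in> carrier (bullet A)" and g: "g \<in> carrier (bullet A)"
    show "comul (bullet A) (f + g) = comul (bullet A) f + comul (bullet A) g"
    proof (rule bullet_comul_eqI[OF A(1,2) vspace_add[OF B f g]])
      show t: "comul (bullet A) f + comul (bullet A) g \<in> carrier ?T"
        by (rule vspace_add[OF is_vspace_tensor comul(1)[OF f] comul(1)[OF g]])
      fix x y assume "x \<in> carrier A" "y \<in> carrier A"
      thus "phi A A (comul (bullet A) f + comul (bullet A) g) (tens A A x y) =
          (f + g) (mul A (tens A A x y))"
        by (simp only: phi[OF _ _ t] linear_map_add[OF e comul(1)[OF f] comul(1)[OF g]]
            comul(2)[OF f] comul(2)[OF g] plus_fun_apply)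
    qed
  next
    fix f r assume f: "f \<in> carrier (bullet A)"
    show "comul (bullet A) (smult (bullet A) r f) = smult ?T r (comul (bullet A) f)"
    proof (rule bullet_comul_eqI[OF A(1,2) vspace_scale[OF B f]])
      show t: "smult ?T r (comul (bullet A) f) \<in> carrier ?T"
        by (rule vspace_scale[OF is_vspace_tensor comul(1)[OF f]])
      fix x y assume "x \<in> carrier A" "y \<in> carrier A"
      thus "phi A A (smult ?T r (comul (bullet A) f)) (tens A A x y) =
          smult (bullet A) r f (mul A (tens A A x y))"
        by (simp only: phi[OF _ _ t] linear_map_scale[OF e comul(1)[OF f]]
            comul(2)[OF f] bullet_simps fscale_apply smult_base)
    qed
  qed (rule comul(1))
  moreover have "lift (bullet A) (bullet A) (bullet A)
        (\<lambda>y z. smult (bullet A) (counit (bullet A) y) z) (comul (bullet A) f) = f \<and>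
      lift (bullet A) (bullet A) (bullet A)
        (\<lambda>y z. smult (bullet A) (counit (bullet A) z) y) (comul (bullet A) f) = f"
    if f: "f \<in> carrier (bullet A)" for f
  proof -
    obtain g h and n :: nat where gh: "\<And>i. g i \<in> carrier (bullet A)" "\<And>i. h i \<in> carrier (bullet A)"
      and n: "comul (bullet A) f = (\<Sum>i<n. tens (bullet A) (bullet A) (g i) (h i))"
      and eq: "\<And>x y. x \<in> carrier A \<Longrightarrow> y \<in> carrier A \<Longrightarrow>
        f (mul A (tens A A x y)) = (\<Sum>i<n. g i x * h i y)"
      by (rule bullet_comul_expand[OF A(1,2) f]) (rule that)
    have Lin: "f \<in> Lin A base" "g i \<in> Lin A base" "h i \<in> Lin A base" for i
      using bullet_in_Lin[OF A(1)] f gh by blast+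
    have "bilinear_map (bullet A) (bullet A) (bullet A) (\<lambda>y z. smult (bullet A) (counit (bullet A) y) z)"
      "bilinear_map (bullet A) (bullet A) (bullet A) (\<lambda>y z. smult (bullet A) (counit (bullet A) z) y)"
      using vspace_scale[OF B] by (auto simp: bilinear_map_def linear_map_def fun_eq_iff algebra_simps)
    note lift = this[THEN lift_sum[OF B B B], of "{..<n}" g h, OF gh, folded n]
    \<comment> \<open>On the carrier the two sums evaluate to f(1x) and f(x1); off the carrier every
      functional involved vanishes.\<close>
    have "(\<Sum>i<n. fscale (g i (unit A 1)) (h i)) x = f x \<and>
        (\<Sum>i<n. fscale (h i (unit A 1)) (g i)) x = f x" for x
    proof (cases "x \<in> carrier A")
      case True
      thus ?thesis using eq[OF A(4)[of 1] True] eq[OF True A(4)[of 1]] A(6,7)[OF True]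
        by (simp add: sum_fun_apply mult.commute)
    qed (simp add: sum_fun_apply LinD(2)[OF Lin(1)] LinD(2)[OF Lin(2)] LinD(2)[OF Lin(3)])
    thus ?thesis unfolding lift by (simp add: fun_eq_iff)
  qed
  ultimately show ?thesis
    unfolding noncoassoc_coalgebra_def using B by (auto intro: linear_map_apply)
qed


text \<open>Under ev_x \<otimes> (ev_y \<otimes> ev_z) the two sides of coassociativity at f become
  f((xy)z) and f(x(yz)).\<close>

lemma coassociative_bullet:
  fixes A :: "('k::field, 'v::ab_group_add) bistruct"
  assumes alg: "nonassoc_algebra A" and assoc: "associative A"
  shows "coassociative (bullet A)"
  unfolding coassociative_def
proof
  fix f assume f: "f \<in> carrier (bullet A)"
  note A = nonassoc_algebraD[OF alg] and B = is_vspace_bullet[of A]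
  note comul = bullet_comul[OF A(1,2)]
  note C = noncoassoc_coalgebraD[OF noncoassoc_coalgebra_bullet[OF alg]]
  let ?B = "bullet A"
  let ?T = "tensor ?B ?B"
  note T = is_vspace_tensor[of ?B ?B] and K = is_vspace_base
  let ?s = "tassoc ?B ?B ?B (tmap ?B ?B ?T ?B (comul ?B) (id_map ?B) (comul ?B f))"
  let ?t = "tmap ?B ?B ?B ?T (id_map ?B) (comul ?B) (comul ?B f)"
  let ?ev = "\<lambda>x g. g x :: 'k"
  let ?ev2 = "\<lambda>y z. lift ?B ?B base (\<lambda>g h. g y * h z)"
  have ev: "linear_map ?B base (?ev x)" for x by (rule linear_map_apply) simp
  have ev2: "linear_map ?T base (?ev2 y z)" for y z
    by (intro linear_map_lift B K bilinear_map_mult ev)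
  note id = linear_map_id_map[OF B]
  have s: "?s \<in> carrier (tensor ?B ?T)"
    by (intro linear_map_closed[OF linear_map_tassoc] linear_map_closed[OF linear_map_tmap]
        B C(2) id comul(1) f)
  have t: "?t \<in> carrier (tensor ?B ?T)"
    by (intro linear_map_closed[OF linear_map_tmap] B C(2) id comul(1) f)
  have "?s - ?t = 0"
  \<comment> \<open>The second factor is itself a tensor square; the functionals ev_y \<otimes> ev_z
    separate its points by \<open>phi_inj\<close>.\<close>
  proof (rule tensor_separation[OF B T, where P = "{?ev x | x. x \<in> carrier A}"
        and Q = "{?ev2 y z | y z. y \<in> carrier A \<and> z \<in> carrier A}"])
    show st: "?s - ?t \<in> carrier (tensor ?B ?T)" by (rule vspace_diff[OF is_vspace_tensor s t])
    fix p q assume "p \<in> {?ev x | x. x \<in> carrier A}"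
      "q \<in> {?ev2 y z | y z. y \<in> carrier A \<and> z \<in> carrier A}"
    then obtain x y z where pq: "p = ?ev x" "q = ?ev2 y z"
      and x: "x \<in> carrier A" and y: "y \<in> carrier A" and z: "z \<in> carrier A" by blast
    let ?L = "lift ?B ?T base (\<lambda>g t. p g * q t)"
    have L: "linear_map (tensor ?B ?T) base ?L"
      unfolding pq by (intro linear_map_lift B T K bilinear_map_mult ev ev2)
    have "?L ?s = lift ?B ?B base (\<lambda>g h. ?ev2 x y (comul ?B g) * h z) (comul ?B f)"
      unfolding pq by (rule coassoc_left_eval[OF B C(2) f ev ev ev])
    also have "\<dots> = ?ev2 (mul A (tens A A x y)) z (comul ?B f)"
      by (rule fun_cong[OF lift_eqI]) (simp only: comul(2)[OF _ x y])
    also have "\<dots> = f (mul A (tens A A (mul A (tens A A x y)) z))"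
      by (rule comul(2)[OF f A(8)[OF x y] z])
    also have "\<dots> = f (mul A (tens A A x (mul A (tens A A y z))))"
      using assoc x y z by (simp add: associative_def)
    also have "\<dots> = ?ev2 x (mul A (tens A A y z)) (comul ?B f)"
      by (rule comul(2)[OF f x A(8)[OF y z], symmetric])
    also have "\<dots> = lift ?B ?B base (\<lambda>g h. g x * ?ev2 y z (comul ?B h)) (comul ?B f)"
      by (rule fun_cong[OF lift_eqI]) (simp only: comul(2)[OF _ y z])
    also have "\<dots> = ?L ?t"
      unfolding pq by (rule coassoc_right_eval[OF B C(2) f ev ev ev, symmetric])
    finally have "?L ?s = ?L ?t" .
    moreover have "?L ?s = ?L (?s - ?t) + ?L ?t"
      using linear_map_add[OF L st t] by simp
    ultimately show "?L (?s - ?t) = 0" by simp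
  next
    fix g assume g: "g \<in> carrier ?B" and p: "\<And>p. p \<in> {?ev x | x. x \<in> carrier A} \<Longrightarrow> p g = 0"
    show "g = 0"
    proof
      fix x show "g x = 0 x"
        using LinD(2)[OF bullet_in_Lin[OF A(1) g], of x] p[of "?ev x"] by auto
    qed
  next
    fix t assume t: "t \<in> carrier ?T"
      and q: "\<And>q. q \<in> {?ev2 y z | y z. y \<in> carrier A \<and> z \<in> carrier A} \<Longrightarrow> q t = 0"
    show "t = 0"
    proof (rule phi_inj[OF A(1) A(1)])
      show "t \<in> carrier (tensor (dual A) (dual A))" "0 \<in> carrier (tensor (dual A) (dual A))"
        using tensor_bullet_subset[OF A(1)] t vspace_zero[OF is_vspace_tensor] by auto
      fix y z assume yz: "y \<in> carrier A" "z \<in> carrier A"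
      hence "phi A A t (tens A A y z) = ?ev2 y z t"
        by (intro phi_tens_eq_lift A(1) B t carrier_bullet_subset bullet_simps)
      also have "\<dots> = 0" using q yz by blast
      finally show "phi A A t (tens A A y z) = phi A A 0 (tens A A y z)"
        by (simp add: linear_map_zero[OF is_vspace_tensor linear_map_phi[OF A(1) A(1)]])
    qed
  qed (use ev ev2 in blast)+
  thus "?s = ?t" by simp
qed

section \<open>The convolution product\<close>

text \<open>Convolution is treated on the full dual first, as closure of \<open>bullet A\<close>
  under it is proved only later, in \<open>conv_in_bullet\<close>.\<close>

lemma linear_map_conv:
  assumes A: "is_vspace A" "linear_map A (tensor A A) (comul A)"
  shows "linear_map (tensor (dual A) (dual A)) (dual A) (mul (bullet A))"
proof -
  have eq: "mul (bullet A) = (\<lambda>t. transpose_map A (comul A) (phi A A t))"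
    by (simp add: bullet_def)
  note phi = linear_map_phi[OF A(1) A(1)]
  show ?thesis
    unfolding eq
  proof (rule linear_map_into_dual[OF _ is_vspace_tensor])
    fix t assume t: "t \<in> carrier (tensor (dual A) (dual A))"
    hence "phi A A t \<in> Lin (tensor A A) base"
      using linear_map_closed[OF phi t] by (simp add: carrier_dual)
    thus "transpose_map A (comul A) (phi A A t) \<in> Lin A base" by (rule transpose_in_Lin[OF A])
  next
    fix x assume "x \<in> carrier A"
    thus "linear_map (tensor (dual A) (dual A)) base
        (\<lambda>t. transpose_map A (comul A) (phi A A t) x)"
      using linear_map_compose[OF phi linear_map_apply[OF smult_dual]] by (simp add: transpose_map_def)
  qed
qed

lemma conv_apply:
  assumes A: "is_vspace A" and f: "f \<in> Lin A base" and g: "g \<in> Lin A base" and x: "x \<in> carrier A"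
  shows "mul (bullet A) (tens (bullet A) (bullet A) f g) x = lift A A base (\<lambda>v w. f v * g w) (comul A x)"
  using x by (simp add: bullet_def transpose_map_def phi_tens[OF A A f g])

lemma conv_sum:
  assumes A: "is_vspace A" and f: "f \<in> Lin A base" and g: "g \<in> Lin A base" and x: "x \<in> carrier A"
    and ab: "\<And>i. i \<in> I \<Longrightarrow> a i \<in> carrier A" "\<And>i. i \<in> I \<Longrightarrow> b i \<in> carrier A"
    and eq: "comul A x = (\<Sum>i\<in>I. tens A A (a i) (b i))"
  shows "mul (bullet A) (tens (bullet A) (bullet A) f g) x = (\<Sum>i\<in>I. f (a i) * g (b i))"
  unfolding conv_apply[OF A f g x] eq
  by (rule lift_sum[OF A A is_vspace_base bilinear_map_mult[OF LinD(1)[OF f] LinD(1)[OF g]] ab])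

lemma conv_in_Lin:
  assumes "is_vspace A" "linear_map A (tensor A A) (comul A)" "f \<in> Lin A base" "g \<in> Lin A base"
  shows "mul (bullet A) (tens (bullet A) (bullet A) f g) \<in> Lin A base"
proof -
  have "tens (bullet A) (bullet A) = tens (dual A) (dual A)" by (rule tens_cong) simp_all
  thus ?thesis
    using linear_map_closed[OF linear_map_conv[OF assms(1,2)], of "tens (dual A) (dual A) f g"]
    by (simp add: tens_in_tensor carrier_dual assms(3,4))
qed

lemma bialgebraD:
  assumes "bialgebra A"
  shows "nonassoc_algebra A" "noncoassoc_coalgebra A"
    "comul A (unit A 1) = tens A A (unit A 1) (unit A 1)" "counit A (unit A 1) = 1"
    "x \<in> carrier A \<Longrightarrow> y \<in> carrier A \<Longrightarrow> counit A (mul A (tens A A x y)) = counit A x * counit A y"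
    "x \<in> carrier A \<Longrightarrow> y \<in> carrier A \<Longrightarrow> comul A (mul A (tens A A x y)) =
       mul (tensor_struct A A) (tens (tensor A A) (tensor A A) (comul A x) (comul A y))"
  using assms by (auto simp: bialgebra_def)

lemma sum_swap4:
  "(\<Sum>k\<in>K. \<Sum>l\<in>L. \<Sum>i\<in>I. \<Sum>j\<in>J. X k l i j) = (\<Sum>i\<in>I. \<Sum>j\<in>J. \<Sum>k\<in>K. \<Sum>l\<in>L. X k l i j)"
proof -
  have "(\<Sum>k\<in>K. \<Sum>l\<in>L. \<Sum>i\<in>I. \<Sum>j\<in>J. X k l i j) = (\<Sum>k\<in>K. \<Sum>i\<in>I. \<Sum>l\<in>L. \<Sum>j\<in>J. X k l i j)"
    by (intro sum.cong refl sum.swap)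
  also have "\<dots> = (\<Sum>i\<in>I. \<Sum>k\<in>K. \<Sum>j\<in>J. \<Sum>l\<in>L. X k l i j)"
    by (subst sum.swap) (intro sum.cong refl sum.swap)
  also have "\<dots> = (\<Sum>i\<in>I. \<Sum>j\<in>J. \<Sum>k\<in>K. \<Sum>l\<in>L. X k l i j)"
    by (intro sum.cong refl sum.swap)
  finally show ?thesis .
qed

text \<open>The central Sweedler computation, driven by \<Delta>(xy) = \<Delta>(x)\<Delta>(y): f*g
  at xy is \<Sum> f(x1 y1) g(x2 y2) = \<Sum> f1(x1) f2(y1) g1(x2) g2(y2), and regrouping by x and y
  gives \<Sum> (f1*g1)(x) (f2*g2)(y). It yields both closure under convolution and multiplicativity
  of the dual coproduct.\<close>

lemma conv_mul_expand:
  fixes A :: "('k::field, 'v::ab_group_add) bistruct"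
  assumes bi: "bialgebra A" and f: "f \<in> Lin A base" and g: "g \<in> Lin A base"
    and Lin: "\<And>i. i \<in> I \<Longrightarrow> f1 i \<in> Lin A base" "\<And>i. i \<in> I \<Longrightarrow> f2 i \<in> Lin A base"
      "\<And>j. j \<in> J \<Longrightarrow> g1 j \<in> Lin A base" "\<And>j. j \<in> J \<Longrightarrow> g2 j \<in> Lin A base"
    and f12: "\<And>x y. x \<in> carrier A \<Longrightarrow> y \<in> carrier A \<Longrightarrow> f (mul A (tens A A x y)) = (\<Sum>i\<in>I. f1 i x * f2 i y)"
    and g12: "\<And>x y. x \<in> carrier A \<Longrightarrow> y \<in> carrier A \<Longrightarrow> g (mul A (tens A A x y)) = (\<Sum>j\<in>J. g1 j x * g2 j y)"
    and x: "x \<in> carrier A" and y: "y \<in> carrier A"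
  shows "mul (bullet A) (tens (bullet A) (bullet A) f g) (mul A (tens A A x y)) =
    (\<Sum>i\<in>I. \<Sum>j\<in>J. mul (bullet A) (tens (bullet A) (bullet A) (f1 i) (g1 j)) x *
                    mul (bullet A) (tens (bullet A) (bullet A) (f2 i) (g2 j)) y)"
proof -
  note A = nonassoc_algebraD[OF bialgebraD(1)[OF bi]] and C = noncoassoc_coalgebraD[OF bialgebraD(2)[OF bi]]
  obtain a b and n :: nat where ab: "\<And>i. a i \<in> carrier A" "\<And>i. b i \<in> carrier A"
    and n: "comul A x = (\<Sum>i<n. tens A A (a i) (b i))"
    by (rule tensor_expand[OF A(1) A(1) C(4)[OF x]]) (rule that)
  obtain c d and m :: nat where cd: "\<And>i. c i \<in> carrier A" "\<And>i. d i \<in> carrier A"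
    and m: "comul A y = (\<Sum>i<m. tens A A (c i) (d i))"
    by (rule tensor_expand[OF A(1) A(1) C(4)[OF y]]) (rule that)
  have "comul A (mul A (tens A A x y)) =
      (\<Sum>k<n. \<Sum>l<m. tens A A (mul A (tens A A (a k) (c l))) (mul A (tens A A (b k) (d l))))"
    unfolding bialgebraD(6)[OF bi x y] n m by (rule mul_tensor_struct_sum[OF A(1,2) ab cd])
  hence "mul (bullet A) (tens (bullet A) (bullet A) f g) (mul A (tens A A x y)) =
      (\<Sum>k<n. \<Sum>l<m. f (mul A (tens A A (a k) (c l))) * g (mul A (tens A A (b k) (d l))))"
    unfolding sum.cartesian_product case_prod_unfold
    by (intro conv_sum A(1,8) f g x y ab cd)
  also have "\<dots> = (\<Sum>k<n. \<Sum>l<m. \<Sum>i\<in>I. \<Sum>j\<in>J.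
      (f1 i (a k) * f2 i (c l)) * (g1 j (b k) * g2 j (d l)))"
    by (simp add: f12 g12 ab cd sum_product)
  also have "\<dots> = (\<Sum>i\<in>I. \<Sum>j\<in>J. \<Sum>k<n. \<Sum>l<m.
      (f1 i (a k) * f2 i (c l)) * (g1 j (b k) * g2 j (d l)))"
    by (rule sum_swap4)
  also have "\<dots> = (\<Sum>i\<in>I. \<Sum>j\<in>J. (\<Sum>k<n. f1 i (a k) * g1 j (b k)) * (\<Sum>l<m. f2 i (c l) * g2 j (d l)))"
    by (simp add: sum_product mult_ac)
  also have "\<dots> = (\<Sum>i\<in>I. \<Sum>j\<in>J. mul (bullet A) (tens (bullet A) (bullet A) (f1 i) (g1 j)) x *
                    mul (bullet A) (tens (bullet A) (bullet A) (f2 i) (g2 j)) y)"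
    by (intro sum.cong refl arg_cong2[where f = "(*)"] conv_sum[symmetric] A(1) x y ab cd n m Lin)
  finally show ?thesis .
qed

text \<open>By \<open>conv_mul_expand\<close>, the factors of a convolution product are again
  convolution products. The set of all of them therefore meets the criterion
  \<open>bullet_memI\<close>, with pairs as indices.\<close>

lemma conv_in_bullet:
  assumes bi: "bialgebra A" and f: "f \<in> carrier (bullet A)" and g: "g \<in> carrier (bullet A)"
  shows "mul (bullet A) (tens (bullet A) (bullet A) f g) \<in> carrier (bullet A)"
proof -
  note A = nonassoc_algebraD[OF bialgebraD(1)[OF bi]] and C = noncoassoc_coalgebraD[OF bialgebraD(2)[OF bi]]
  let ?m = "\<lambda>f g. mul (bullet A) (tens (bullet A) (bullet A) f g)"
  let ?S = "{?m f g | f g. f \<in> carrier (bullet A) \<and> g \<in> carrier (bullet A)}"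
  note Lin = bullet_in_Lin[OF A(1)]
  show ?thesis
  proof (rule bullet_memI[OF A(1,2), where S = ?S])
    show "?S \<subseteq> Lin A base" using conv_in_Lin[OF C(1,2) Lin Lin] by blast
    show "?m f g \<in> ?S" using f g by blast
    fix h assume "h \<in> ?S"
    then obtain f g where h: "h = ?m f g" and f: "f \<in> carrier (bullet A)" and g: "g \<in> carrier (bullet A)"
      by blast
    obtain f1 f2 and n :: nat where f12: "\<And>i. f1 i \<in> carrier (bullet A)" "\<And>i. f2 i \<in> carrier (bullet A)"
      "comul (bullet A) f = (\<Sum>i<n. tens (bullet A) (bullet A) (f1 i) (f2 i))"
      "\<And>x y. x \<in> carrier A \<Longrightarrow> y \<in> carrier A \<Longrightarrow> f (mul A (tens A A x y)) = (\<Sum>i<n. f1 i x * f2 i y)"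
      by (rule bullet_comul_expand[OF A(1,2) f]) (rule that)
    obtain g1 g2 and m :: nat where g12: "\<And>i. g1 i \<in> carrier (bullet A)" "\<And>i. g2 i \<in> carrier (bullet A)"
      "comul (bullet A) g = (\<Sum>i<m. tens (bullet A) (bullet A) (g1 i) (g2 i))"
      "\<And>x y. x \<in> carrier A \<Longrightarrow> y \<in> carrier A \<Longrightarrow> g (mul A (tens A A x y)) = (\<Sum>i<m. g1 i x * g2 i y)"
      by (rule bullet_comul_expand[OF A(1,2) g]) (rule that)
    have "h (mul A (tens A A x y)) = (\<Sum>p\<in>{..<n} \<times> {..<m}. ?m (f1 (fst p)) (g1 (snd p)) x * ?m (f2 (fst p)) (g2 (snd p)) y)"
      if "x \<in> carrier A" "y \<in> carrier A" for x y
      unfolding h conv_mul_expand[OF bi Lin[OF f] Lin[OF g] Lin[OF f12(1)] Lin[OF f12(2)]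
          Lin[OF g12(1)] Lin[OF g12(2)] f12(4) g12(4) that, simplified]
      by (simp add: sum.cartesian_product case_prod_unfold)
    moreover have "\<forall>p\<in>{..<n} \<times> {..<m}. ?m (f1 (fst p)) (g1 (snd p)) \<in> ?S \<and> ?m (f2 (fst p)) (g2 (snd p)) \<in> ?S"
      using f12(1,2) g12(1,2) by blast
    ultimately show "\<exists>(I::(nat \<times> nat) set) g k. (\<forall>i\<in>I. g i \<in> ?S \<and> k i \<in> ?S) \<and>
      (\<forall>x\<in>carrier A. \<forall>y\<in>carrier A. h (mul A (tens A A x y)) = (\<Sum>i\<in>I. g i x * k i y))"
      by (intro exI conjI ballI) auto
  qed
qed

lemma bullet_unit_apply:
  "unit (bullet A) 1 = (\<lambda>x. if x \<in> carrier A then counit A x else 0)"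
  by (simp add: transpose_map_def fun_eq_iff)

lemma bullet_unit_in_Lin:
  assumes "is_vspace A" "linear_map A base (counit A)"
  shows "unit (bullet A) 1 \<in> Lin A base"
  using transpose_in_Lin[OF assms, of "\<lambda>s. s"] by (simp add: Lin_def linear_map_def transpose_map_def fscale_def)

text \<open>Since \<epsilon>(xy) = \<epsilon>(x)\<epsilon>(y), the singleton of the normalised
  counit meets the criterion \<open>bullet_memI\<close> with a one-element index set.\<close>

lemma bullet_unit_in_bullet:
  assumes bi: "bialgebra A"
  shows "unit (bullet A) 1 \<in> carrier (bullet A)"
proof -
  note A = nonassoc_algebraD[OF bialgebraD(1)[OF bi]] and C = noncoassoc_coalgebraD[OF bialgebraD(2)[OF bi]]
  show ?thesis
  proof (rule bullet_memI[OF A(1,2), where S = "{unit (bullet A) 1}"])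
    fix f assume "f \<in> {unit (bullet A) 1}"
    hence f: "f = (\<lambda>x. if x \<in> carrier A then counit A x else 0)" by (simp only: bullet_unit_apply singleton_iff)
    show "\<exists>(I::unit set) g h. (\<forall>i\<in>I. g i \<in> {unit (bullet A) 1} \<and> h i \<in> {unit (bullet A) 1}) \<and>
      (\<forall>x\<in>carrier A. \<forall>y\<in>carrier A. f (mul A (tens A A x y)) = (\<Sum>i\<in>I. g i x * h i y))"
      unfolding bullet_unit_apply
      by (rule exI[of _ "{()}"], intro exI[of _ "\<lambda>_. f"]) (simp add: f A(8) bialgebraD(5)[OF bi])
  qed (use bullet_unit_in_Lin[OF C(1,3)] in blast)+
qed

text \<open>The unit laws for convolution are f applied to the two counit laws \<Sum> \<epsilon>(x1)
  x2 = x = \<Sum> \<epsilon>(x2) x1.\<close>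

lemma nonassoc_algebra_bullet:
  fixes A :: "('k::field, 'v::ab_group_add) bistruct"
  assumes bi: "bialgebra A"
  shows "nonassoc_algebra (bullet A)"
proof -
  note A = nonassoc_algebraD[OF bialgebraD(1)[OF bi]] and C = noncoassoc_coalgebraD[OF bialgebraD(2)[OF bi]]
  note B = is_vspace_bullet[of A] and unit = bullet_unit_in_bullet[OF bi]
  note Lin = bullet_in_Lin[OF A(1)] and conv = linear_map_conv[OF C(1,2)]
  let ?T = "tensor (bullet A) (bullet A)"
  have "mul (bullet A) t \<in> carrier (bullet A)" if t: "t \<in> carrier ?T" for t
  proof -
    obtain f g and n :: nat where fg: "\<And>i. f i \<in> carrier (bullet A)" "\<And>i. g i \<in> carrier (bullet A)"
      and tn: "t = (\<Sum>i<n. tens (bullet A) (bullet A) (f i) (g i))"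
      by (rule tensor_expand[OF B B t]) (rule that)
    have "mul (bullet A) t = (\<Sum>i<n. mul (bullet A) (tens (bullet A) (bullet A) (f i) (g i)))"
      unfolding tn by (rule linear_map_sum[OF is_vspace_tensor conv])
        (use tensor_bullet_subset[OF A(1)] tens_in_tensor fg in blast)
    thus ?thesis using vspace_sum[OF B conv_in_bullet[OF bi fg]] by simp
  qed
  hence "linear_map ?T (bullet A) (mul (bullet A))"
    using conv subsetD[OF tensor_bullet_subset[OF A(1)]] by (auto simp: linear_map_def)
  moreover have "linear_map base (bullet A) (unit (bullet A))"
  proof -
    have "unit (bullet A) = (\<lambda>r. smult (bullet A) r (unit (bullet A) 1))"
      by (simp add: fscale_fscale)
    thus ?thesis by (rule ssubst) (rule linear_map_scaled[OF B unit])
  qed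
  moreover have "mul (bullet A) (tens (bullet A) (bullet A) (unit (bullet A) 1) f) = f \<and>
      mul (bullet A) (tens (bullet A) (bullet A) f (unit (bullet A) 1)) = f"
    if f: "f \<in> carrier (bullet A)" for f
  proof (intro conjI; rule Lin_eqI)
    fix x assume x: "x \<in> carrier A"
    note f' = LinD(1)[OF Lin[OF f]]
    obtain a b and n :: nat where ab: "\<And>i. a i \<in> carrier A" "\<And>i. b i \<in> carrier A"
      and n: "comul A x = (\<Sum>i<n. tens A A (a i) (b i))"
      by (rule tensor_expand[OF A(1) A(1) C(4)[OF x]]) (rule that)
    have "f (\<Sum>i<n. smult A (counit A (a i)) (b i)) = (\<Sum>i<n. counit A (a i) * f (b i))"
      "f (\<Sum>i<n. smult A (counit A (b i)) (a i)) = (\<Sum>i<n. f (a i) * counit A (b i))"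
      using A(1) ab by (simp_all add: linear_map_sum[OF A(1) f'] vspace_scale linear_map_scale[OF f'] mult.commute)
    moreover note counit_expand[OF bialgebraD(2)[OF bi] x ab n]
    moreover note conv_sum[OF A(1) Lin[OF unit] Lin[OF f] x ab n] conv_sum[OF A(1) Lin[OF f] Lin[OF unit] x ab n]
    ultimately show "mul (bullet A) (tens (bullet A) (bullet A) (unit (bullet A) 1) f) x = f x"
      "mul (bullet A) (tens (bullet A) (bullet A) f (unit (bullet A) 1)) x = f x"
      unfolding bullet_unit_apply by (simp_all add: ab)
  qed (rule conv_in_Lin[OF C(1,2)] Lin unit f)+
  ultimately show ?thesis
    unfolding nonassoc_algebra_def using B by blast
qed

text \<open>The axioms are exchanged in pairs. Multiplicativity of \<epsilon> makes the new unit
  grouplike; \<Delta>(1) = 1 \<otimes> 1 makes the new counit multiplicative; \<epsilon>(1) = 1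
  dualises to itself; multiplicativity of \<Delta> gives that of the new coproduct through
  \<open>conv_mul_expand\<close>.\<close>

lemma bialgebra_bullet:
  fixes A :: "('k::field, 'v::ab_group_add) bistruct"
  assumes bi: "bialgebra A"
  shows "bialgebra (bullet A)"
proof -
  note A = nonassoc_algebraD[OF bialgebraD(1)[OF bi]] and C = noncoassoc_coalgebraD[OF bialgebraD(2)[OF bi]]
  note B = nonassoc_algebraD[OF nonassoc_algebra_bullet[OF bi]] and unit = bullet_unit_in_bullet[OF bi]
  note Lin = bullet_in_Lin[OF A(1)]
  let ?m = "\<lambda>f g. mul (bullet A) (tens (bullet A) (bullet A) f g)"
  let ?T = "tensor (bullet A) (bullet A)"
  have "comul (bullet A) (unit (bullet A) 1) = tens (bullet A) (bullet A) (unit (bullet A) 1) (unit (bullet A) 1)"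
  proof (rule bullet_comul_eqI[OF A(1,2) unit tens_in_tensor[OF unit unit]])
    fix x y assume xy: "x \<in> carrier A" "y \<in> carrier A"
    have "phi A A (tens (bullet A) (bullet A) (unit (bullet A) 1) (unit (bullet A) 1)) (tens A A x y) =
        unit (bullet A) 1 x * unit (bullet A) 1 y"
      using phi_sum_tens[where I = "{()}", OF A(1) A(1) Lin[OF unit] Lin[OF unit] xy
          bullet_simps(2) bullet_simps(2)]
      by simp
    thus "phi A A (tens (bullet A) (bullet A) (unit (bullet A) 1) (unit (bullet A) 1)) (tens A A x y) =
        unit (bullet A) 1 (mul A (tens A A x y))"
      unfolding bullet_unit_apply by (simp add: xy A(8) bialgebraD(5)[OF bi])
  qed
  moreover have "counit (bullet A) (unit (bullet A) 1) = 1"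
    using A(4)[of 1] bialgebraD(4)[OF bi] unfolding bullet_unit_apply by simp
  moreover have "counit (bullet A) (?m f g) = counit (bullet A) f * counit (bullet A) g \<and>
      comul (bullet A) (?m f g) = mul (tensor_struct (bullet A) (bullet A)) (tens ?T ?T (comul (bullet A) f) (comul (bullet A) g))"
    if f: "f \<in> carrier (bullet A)" and g: "g \<in> carrier (bullet A)" for f g
  proof
    show "counit (bullet A) (?m f g) = counit (bullet A) f * counit (bullet A) g"
      using conv_sum[OF A(1) Lin[OF f] Lin[OF g] A(4)[of 1], of "{()}" "\<lambda>_. unit A 1" "\<lambda>_. unit A 1"]
        A(4) bialgebraD(3)[OF bi] by simp
    obtain f1 f2 and n :: nat where f12: "\<And>i. f1 i \<in> carrier (bullet A)" "\<And>i. f2 i \<in> carrier (bullet A)"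
      and fn: "comul (bullet A) f = (\<Sum>i<n. tens (bullet A) (bullet A) (f1 i) (f2 i))"
      and f': "\<And>x y. x \<in> carrier A \<Longrightarrow> y \<in> carrier A \<Longrightarrow> f (mul A (tens A A x y)) = (\<Sum>i<n. f1 i x * f2 i y)"
      by (rule bullet_comul_expand[OF A(1,2) f]) (rule that)
    obtain g1 g2 and m :: nat where g12: "\<And>i. g1 i \<in> carrier (bullet A)" "\<And>i. g2 i \<in> carrier (bullet A)"
      and gm: "comul (bullet A) g = (\<Sum>i<m. tens (bullet A) (bullet A) (g1 i) (g2 i))"
      and g': "\<And>x y. x \<in> carrier A \<Longrightarrow> y \<in> carrier A \<Longrightarrow> g (mul A (tens A A x y)) = (\<Sum>i<m. g1 i x * g2 i y)"
      by (rule bullet_comul_expand[OF A(1,2) g]) (rule that)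
    have eq: "mul (tensor_struct (bullet A) (bullet A)) (tens ?T ?T (comul (bullet A) f) (comul (bullet A) g)) =
        (\<Sum>i<n. \<Sum>j<m. tens (bullet A) (bullet A) (?m (f1 i) (g1 j)) (?m (f2 i) (g2 j)))"
      unfolding fn gm by (rule mul_tensor_struct_sum[OF B(1,2) f12 g12])
    show "comul (bullet A) (?m f g) = mul (tensor_struct (bullet A) (bullet A)) (tens ?T ?T (comul (bullet A) f) (comul (bullet A) g))"
      unfolding eq
    proof (rule bullet_comul_eqI[OF A(1,2) B(8)[OF f g]])
      show "(\<Sum>i<n. \<Sum>j<m. tens (bullet A) (bullet A) (?m (f1 i) (g1 j)) (?m (f2 i) (g2 j))) \<in> carrier ?T"
        by (intro vspace_sum is_vspace_tensor tens_in_tensor B(8) f12 g12)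
      fix x y assume xy: "x \<in> carrier A" "y \<in> carrier A"
      show "phi A A (\<Sum>i<n. \<Sum>j<m. tens (bullet A) (bullet A) (?m (f1 i) (g1 j)) (?m (f2 i) (g2 j))) (tens A A x y) =
          ?m f g (mul A (tens A A x y))"
        unfolding conv_mul_expand[OF bi Lin[OF f] Lin[OF g] Lin[OF f12(1)] Lin[OF f12(2)]
            Lin[OF g12(1)] Lin[OF g12(2)] f' g' xy, simplified]
        by (intro phi_double_sum_tens A(1) conv_in_Lin C(2) Lin f12 g12 xy bullet_simps)
    qed
  qed
  ultimately show ?thesis
    unfolding bialgebra_def
    using nonassoc_algebra_bullet[OF bi] noncoassoc_coalgebra_bullet[OF bialgebraD(1)[OF bi]] by blast
qed

text \<open>Both bracketings of a triple convolution at x are f \<otimes> (g \<otimes> h) applied to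
  the two sides of coassociativity at x.\<close>

lemma associative_bullet:
  fixes C :: "('k::field, 'v::ab_group_add) bistruct"
  assumes bi: "bialgebra C" and coassoc: "coassociative C"
  shows "associative (bullet C)"
  unfolding associative_def
proof (intro ballI)
  fix f g h assume f: "f \<in> carrier (bullet C)" and g: "g \<in> carrier (bullet C)" and h: "h \<in> carrier (bullet C)"
  note C = noncoassoc_coalgebraD[OF bialgebraD(2)[OF bi]]
  note B = nonassoc_algebraD[OF nonassoc_algebra_bullet[OF bi]]
  note Lin = bullet_in_Lin[OF C(1)]
  let ?m = "\<lambda>f g. mul (bullet C) (tens (bullet C) (bullet C) f g)"
  have fgh: "f \<in> Lin C base" "g \<in> Lin C base" "h \<in> Lin C base" "?m f g \<in> Lin C base" "?m g h \<in> Lin C base"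
    by (intro Lin f g h B(8))+
  note lin = fgh[THEN LinD(1)]
  show "?m (?m f g) h = ?m f (?m g h)"
  proof (rule Lin_eqI[OF Lin Lin])
    fix x assume x: "x \<in> carrier C"
    have "?m (?m f g) h x = lift C C base (\<lambda>y z. ?m f g y * h z) (comul C x)"
      by (rule conv_apply[OF C(1) fgh(4,3) x])
    also have "\<dots> = lift C C base (\<lambda>y z. lift C C base (\<lambda>v w. f v * g w) (comul C y) * h z) (comul C x)"
      by (rule fun_cong[OF lift_eqI]) (simp only: conv_apply[OF C(1) fgh(1,2)])
    also have "\<dots> = lift C C base (\<lambda>y z. f y * lift C C base (\<lambda>v w. g v * h w) (comul C z)) (comul C x)"
      using coassoc x coassoc_left_eval[OF C(1,2) x lin(1,2,3)] coassoc_right_eval[OF C(1,2) x lin(1,2,3)]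
      by (simp add: coassociative_def)
    also have "\<dots> = lift C C base (\<lambda>y z. f y * ?m g h z) (comul C x)"
      by (rule fun_cong[OF lift_eqI]) (simp only: conv_apply[OF C(1) fgh(2,3)])
    also have "\<dots> = ?m f (?m g h) x"
      by (rule conv_apply[OF C(1) fgh(1,5) x, symmetric])
    finally show "?m (?m f g) h x = ?m f (?m g h) x" .
  qed (intro B(8) f g h)+
qed

section \<open>Morphisms and the adjunction\<close>

text \<open>The universal property of \<open>A\<^sup>\<bullet>\<close>: both the restricted transpose of a morphism and the map
  adjoint to a morphism are obtained from it.\<close>

lemma coalgebra_map_into_bullet:
  fixes A :: "('k::field, 'v::ab_group_add) bistruct" and D :: "('k, 'w::ab_group_add) bistruct"
  assumes alg: "nonassoc_algebra A" and D: "noncoassoc_coalgebra D" and F: "linear_map D (dual A) F"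
    and ex: "\<And>d. d \<in> carrier D \<Longrightarrow> \<exists>(n::nat) u v. (\<forall>i. u i \<in> carrier D \<and> v i \<in> carrier D) \<and>
      comul D d = (\<Sum>i<n. tens D D (u i) (v i)) \<and>
      (\<forall>x\<in>carrier A. \<forall>y\<in>carrier A. F d (mul A (tens A A x y)) = (\<Sum>i<n. F (u i) x * F (v i) y))"
    and counit: "\<And>d. d \<in> carrier D \<Longrightarrow> F d (unit A 1) = counit D d"
  shows "coalgebra_map D (bullet A) F"
proof -
  note A = nonassoc_algebraD[OF alg] and D = noncoassoc_coalgebraD[OF D]
  have Lin: "F d \<in> Lin A base" if "d \<in> carrier D" for d
    using linear_map_closed[OF F that] by (simp add: carrier_dual)
  have mem: "F d \<in> carrier (bullet A)" if d: "d \<in> carrier D" for d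
  proof (rule bullet_memI[OF A(1,2), where S = "F ` carrier D"])
    fix f assume "f \<in> F ` carrier D"
    then obtain d where f: "f = F d" and d: "d \<in> carrier D" by blast
    obtain n :: nat and u v where uv: "\<forall>i. u i \<in> carrier D \<and> v i \<in> carrier D"
      "\<forall>x\<in>carrier A. \<forall>y\<in>carrier A. F d (mul A (tens A A x y)) = (\<Sum>i<n. F (u i) x * F (v i) y)"
      using ex[OF d] by (elim exE conjE)
    show "\<exists>(I::nat set) g h. (\<forall>i\<in>I. g i \<in> F ` carrier D \<and> h i \<in> F ` carrier D) \<and>
      (\<forall>x\<in>carrier A. \<forall>y\<in>carrier A. f (mul A (tens A A x y)) = (\<Sum>i\<in>I. g i x * h i y))"
      unfolding f
      by (rule exI[of _ "{..<n}"], rule exI[of _ "\<lambda>i. F (u i)"], rule exI[of _ "\<lambda>i. F (v i)"])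
        (use uv in blast)
  qed (use Lin d in auto)
  \<comment> \<open>With every value of F in \<open>bullet A\<close>, the codomain shrinks from the
    full dual and F \<otimes> F maps into the tensor square of \<open>bullet A\<close>.\<close>
  have F': "linear_map D (bullet A) F"
    using F mem unfolding linear_map_def by simp
  have "comul (bullet A) (F d) = tmap D D (bullet A) (bullet A) F F (comul D d)"
    if d: "d \<in> carrier D" for d
  proof -
    obtain n :: nat and u v where uv: "\<forall>i. u i \<in> carrier D \<and> v i \<in> carrier D"
      and n: "comul D d = (\<Sum>i<n. tens D D (u i) (v i))"
      and eq: "\<forall>x\<in>carrier A. \<forall>y\<in>carrier A. F d (mul A (tens A A x y)) = (\<Sum>i<n. F (u i) x * F (v i) y)"
      using ex[OF d] by (elim exE conjE)
    have "u i \<in> carrier D" "v i \<in> carrier D" for i using uv by auto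
    note Fuv = mem[OF this(1)] mem[OF this(2)] Lin[OF this(1)] Lin[OF this(2)] this
    have t: "tmap D D (bullet A) (bullet A) F F (comul D d) =
        (\<Sum>i<n. tens (bullet A) (bullet A) (F (u i)) (F (v i)))"
      unfolding n by (intro tmap_sum D(1) F' Fuv)
    show ?thesis
      unfolding t
    proof (rule bullet_comul_eqI[OF A(1,2) mem[OF d]])
      show "(\<Sum>i<n. tens (bullet A) (bullet A) (F (u i)) (F (v i))) \<in> carrier (tensor (bullet A) (bullet A))"
        by (intro vspace_sum is_vspace_tensor tens_in_tensor Fuv)
      fix x y assume xy: "x \<in> carrier A" "y \<in> carrier A"
      show "phi A A (\<Sum>i<n. tens (bullet A) (bullet A) (F (u i)) (F (v i))) (tens A A x y) =
          F d (mul A (tens A A x y))"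
        using phi_sum_tens[where I = "{..<n}", OF A(1) A(1) Fuv(3,4) xy bullet_simps(2) bullet_simps(2)] eq xy by simp
    qed
  qed
  with F' counit show ?thesis by (simp add: coalgebra_map_def)
qed

lemma MorD:
  assumes "f \<in> Mor A B"
  shows "f \<in> Lin A B" "linear_map A B f" "algebra_map A B f" "coalgebra_map A B f"
  using assms by (auto simp: Mor_def algebra_map_def)

lemma coalgebra_map_comul_sum:
  assumes "is_vspace C" "coalgebra_map C D f" "x \<in> carrier C"
    and "\<And>i. i \<in> I \<Longrightarrow> a i \<in> carrier C" "\<And>i. i \<in> I \<Longrightarrow> b i \<in> carrier C"
    and "comul C x = (\<Sum>i\<in>I. tens C C (a i) (b i))"
  shows "comul D (f x) = (\<Sum>i\<in>I. tens D D (f (a i)) (f (b i)))"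
  using assms by (simp add: coalgebra_map_def tmap_sum)

text \<open>Multiplicativity of g gives h(g(xy)) = \<Sum> h1(g(x)) h2(g(y)), which is the hypothesis
  of \<open>coalgebra_map_into_bullet\<close> for the transpose. Compatibility of g with \<Delta>
  makes the transpose multiplicative for convolution, and compatibility with \<epsilon> makes it
  preserve the unit.\<close>

lemma bullet_map_in_Mor:
  fixes C :: "('k::field, 'c::ab_group_add) bistruct" and C' :: "('k, 'd::ab_group_add) bistruct"
  assumes bi: "bialgebra C" and bi': "bialgebra C'" and g: "g \<in> Mor C C'"
  shows "bullet_map C C' g \<in> Mor (bullet C') (bullet C)"
proof -
  note A = nonassoc_algebraD[OF bialgebraD(1)[OF bi]] and C = noncoassoc_coalgebraD[OF bialgebraD(2)[OF bi]]
  note A' = nonassoc_algebraD[OF bialgebraD(1)[OF bi']] and C' = noncoassoc_coalgebraD[OF bialgebraD(2)[OF bi']]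
  note B = nonassoc_algebraD[OF nonassoc_algebra_bullet[OF bi]]
  note B' = nonassoc_algebraD[OF nonassoc_algebra_bullet[OF bi']]
  note Lin = bullet_in_Lin[OF A(1)] and Lin' = bullet_in_Lin[OF A'(1)]
  note unit = bullet_unit_in_bullet[OF bi] and unit' = bullet_unit_in_bullet[OF bi']
  let ?F = "bullet_map C C' g"
  note g_lin = MorD(2)[OF g] and g_closed = linear_map_closed[OF MorD(2)[OF g]]
  have g_mul: "g (mul C (tens C C x y)) = mul C' (tens C' C' (g x) (g y))"
    if "x \<in> carrier C" "y \<in> carrier C" for x y
    using MorD(3)[OF g] that by (simp add: algebra_map_iff[OF A(5) A'(5)])
  have g_unit: "g (unit C 1) = unit C' 1" and g_counit: "\<And>x. x \<in> carrier C \<Longrightarrow> counit C' (g x) = counit C x"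
    using MorD(3,4)[OF g] by (simp_all add: algebra_map_def coalgebra_map_def)
  have F: "?F h = transpose_map C g h" if "h \<in> carrier (bullet C')" for h
    using that by (simp add: bullet_map_def)
  have Fx: "?F h x = h (g x)" if "h \<in> carrier (bullet C')" "x \<in> carrier C" for h x
    using that by (simp add: bullet_map_def transpose_map_def)
  have "linear_map (bullet C') (dual C) ?F"
    unfolding linear_map_def
  proof (intro conjI ballI allI)
    fix h assume h: "h \<in> carrier (bullet C')"
    show "?F h \<in> carrier (dual C)"
      using transpose_in_Lin[OF A(1) g_lin Lin'[OF h]] F[OF h] by (simp add: carrier_dual)
    fix h' assume h': "h' \<in> carrier (bullet C')"
    show "?F (h + h') = ?F h + ?F h'"
      unfolding F[OF h] F[OF h'] F[OF vspace_add[OF B'(1) h h']]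
      by (simp add: transpose_map_def fun_eq_iff)
  next
    fix r h assume h: "h \<in> carrier (bullet C')"
    show "?F (smult (bullet C') r h) = smult (dual C) r (?F h)"
      unfolding F[OF h] F[OF vspace_scale[OF B'(1) h]] by (simp add: transpose_map_def fun_eq_iff)
  qed
  hence coalg: "coalgebra_map (bullet C') (bullet C) ?F"
  proof (rule coalgebra_map_into_bullet[OF bialgebraD(1)[OF bi] bialgebraD(2)[OF bialgebra_bullet[OF bi']]])
    fix h assume h: "h \<in> carrier (bullet C')"
    show "?F h (unit C 1) = counit (bullet C') h" using A(4) by (simp add: Fx[OF h] g_unit)
    obtain u v and n :: nat where uv: "\<And>i. u i \<in> carrier (bullet C')" "\<And>i. v i \<in> carrier (bullet C')"
      and n: "comul (bullet C') h = (\<Sum>i<n. tens (bullet C') (bullet C') (u i) (v i))"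
      and eq: "\<And>x y. x \<in> carrier C' \<Longrightarrow> y \<in> carrier C' \<Longrightarrow>
        h (mul C' (tens C' C' x y)) = (\<Sum>i<n. u i x * v i y)"
      by (rule bullet_comul_expand[OF A'(1,2) h]) (rule that)
    show "\<exists>(n::nat) u v. (\<forall>i. u i \<in> carrier (bullet C') \<and> v i \<in> carrier (bullet C')) \<and>
      comul (bullet C') h = (\<Sum>i<n. tens (bullet C') (bullet C') (u i) (v i)) \<and>
      (\<forall>x\<in>carrier C. \<forall>y\<in>carrier C. ?F h (mul C (tens C C x y)) = (\<Sum>i<n. ?F (u i) x * ?F (v i) y))"
      by (intro exI[of _ n] exI[of _ u] exI[of _ v] conjI allI ballI uv n)
        (simp only: Fx[OF h] Fx[OF uv(1)] Fx[OF uv(2)] A(8) g_mul eq g_closed)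
  qed
  hence lin: "linear_map (bullet C') (bullet C) ?F" by (simp add: coalgebra_map_def)
  note FLin = Lin[OF linear_map_closed[OF lin]]
  have "?F (mul (bullet C') (tens (bullet C') (bullet C') h k)) =
      mul (bullet C) (tens (bullet C) (bullet C) (?F h) (?F k))"
    if h: "h \<in> carrier (bullet C')" and k: "k \<in> carrier (bullet C')" for h k
  proof (rule Lin_eqI)
    show "?F (mul (bullet C') (tens (bullet C') (bullet C') h k)) \<in> Lin C base"
      by (intro FLin B'(8) h k)
    show "mul (bullet C) (tens (bullet C) (bullet C) (?F h) (?F k)) \<in> Lin C base"
      by (intro conv_in_Lin C(1,2) FLin h k)
    fix x assume x: "x \<in> carrier C"
    obtain a b and n :: nat where ab: "\<And>i. a i \<in> carrier C" "\<And>i. b i \<in> carrier C"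
      and n: "comul C x = (\<Sum>i<n. tens C C (a i) (b i))"
      by (rule tensor_expand[OF A(1) A(1) C(4)[OF x]]) (rule that)
    show "?F (mul (bullet C') (tens (bullet C') (bullet C') h k)) x =
        mul (bullet C) (tens (bullet C) (bullet C) (?F h) (?F k)) x"
      unfolding Fx[OF B'(8)[OF h k] x] conv_sum[OF A(1) FLin[OF h] FLin[OF k] x ab n]
        conv_sum[OF A'(1) Lin'[OF h] Lin'[OF k] g_closed[OF x] g_closed[OF ab(1)] g_closed[OF ab(2)]
          coalgebra_map_comul_sum[OF A(1) MorD(4)[OF g] x ab n]]
      by (simp only: Fx[OF h ab(1)] Fx[OF k ab(2)])
  qed
  moreover have "?F (unit (bullet C') 1) = unit (bullet C) 1"
  proof
    fix x
    show "?F (unit (bullet C') 1) x = unit (bullet C) 1 x"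
      by (subst F[OF unit'], unfold transpose_map_def bullet_unit_apply) (simp add: g_closed g_counit)
  qed
  ultimately have alg: "algebra_map (bullet C') (bullet C) ?F"
    using lin by (simp only: algebra_map_iff[OF B'(5) B(5)]) blast
  have "?F \<in> Lin (bullet C') (bullet C)" using lin by (simp add: Lin_def bullet_map_def)
  thus ?thesis using alg coalg by (simp add: Mor_def)
qed

text \<open>The conditions on f, evaluated at elements, become the opposite conditions on
  \<open>adj f\<close>: product and unit of f give coproduct and counit of \<open>adj f\<close>
  through \<open>coalgebra_map_into_bullet\<close>, while coproduct and counit of f give product and
  unit.\<close>

lemma adj_in_Mor:
  fixes A :: "('k::field, 'a::ab_group_add) bistruct" and C :: "('k, 'c::ab_group_add) bistruct"
  assumes biA: "bialgebra A" and biC: "bialgebra C" and f: "f \<in> Mor A (bullet C)"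
  shows "adj f \<in> Mor C (bullet A)"
proof -
  note A = nonassoc_algebraD[OF bialgebraD(1)[OF biA]] noncoassoc_coalgebraD[OF bialgebraD(2)[OF biA]]
  note C = nonassoc_algebraD[OF bialgebraD(1)[OF biC]] noncoassoc_coalgebraD[OF bialgebraD(2)[OF biC]]
  note BA = nonassoc_algebraD[OF nonassoc_algebra_bullet[OF biA]]
  note BC = nonassoc_algebraD[OF nonassoc_algebra_bullet[OF biC]]
  let ?F = "adj f"
  have F: "?F c a = f a c" for a c by (simp add: adj_def)
  note f_lin = MorD(2)[OF f] and f_in = linear_map_closed[OF MorD(2)[OF f]]
  note f_Lin = bullet_in_Lin[OF C(1) f_in]
  note f_zero = LinD(2)[OF MorD(1)[OF f]]
  have f_mul: "f (mul A (tens A A x y)) = mul (bullet C) (tens (bullet C) (bullet C) (f x) (f y))"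
    if "x \<in> carrier A" "y \<in> carrier A" for x y
    using MorD(3)[OF f] that by (simp only: algebra_map_iff[OF A(5) BC(5)])
  have f_unit: "f (unit A 1) = unit (bullet C) 1"
    using MorD(3)[OF f] unfolding algebra_map_def by blast
  have f_counit: "f x (unit C 1) = counit A x" if "x \<in> carrier A" for x
    using MorD(4)[OF f] that by (simp add: coalgebra_map_def)
  \<comment> \<open>This makes \<open>adj f\<close> normalised in its outer argument: on
    \<open>carrier A\<close> the value \<open>f a\<close> is a normalised functional on C, and
    elsewhere \<open>f a\<close> is itself zero.\<close>
  have zero: "f a c = 0" if "c \<notin> carrier C" for a c
    using LinD(2)[OF f_Lin that] f_zero by (cases "a \<in> carrier A") auto
  have Lin: "?F c \<in> Lin A base" for c
    unfolding Lin_def linear_map_def F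
    using linear_map_add[OF f_lin] linear_map_scale[OF f_lin] f_zero by simp
  have "linear_map C (dual A) ?F"
  proof (rule linear_map_into_dual[OF Lin C(1)])
    fix a assume "a \<in> carrier A"
    thus "linear_map C base (\<lambda>c. ?F c a)" unfolding F by (intro LinD(1) f_Lin)
  qed
  hence coalg: "coalgebra_map C (bullet A) ?F"
  proof (rule coalgebra_map_into_bullet[OF bialgebraD(1)[OF biA] bialgebraD(2)[OF biC]])
    fix c assume c: "c \<in> carrier C"
    show "?F c (unit A 1) = counit C c"
      unfolding F f_unit bullet_unit_apply using c by simp
    obtain u v and n :: nat where uv: "\<And>i. u i \<in> carrier C" "\<And>i. v i \<in> carrier C"
      and n: "comul C c = (\<Sum>i<n. tens C C (u i) (v i))"
      by (rule tensor_expand[OF C(1) C(1) C(12)[OF c]]) (rule that)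
    show "\<exists>(n::nat) u v. (\<forall>i. u i \<in> carrier C \<and> v i \<in> carrier C) \<and>
      comul C c = (\<Sum>i<n. tens C C (u i) (v i)) \<and>
      (\<forall>x\<in>carrier A. \<forall>y\<in>carrier A. ?F c (mul A (tens A A x y)) = (\<Sum>i<n. ?F (u i) x * ?F (v i) y))"
      by (intro exI[of _ n] exI[of _ u] exI[of _ v] conjI allI ballI uv n)
        (simp only: F f_mul conv_sum[OF C(1) f_Lin f_Lin c uv n])
  qed
  hence lin: "linear_map C (bullet A) ?F" by (simp add: coalgebra_map_def)
  note F_in = linear_map_closed[OF lin]
  have "?F (mul C (tens C C c d)) = mul (bullet A) (tens (bullet A) (bullet A) (?F c) (?F d))"
    if c: "c \<in> carrier C" and d: "d \<in> carrier C" for c d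
  proof (rule Lin_eqI[OF Lin])
    show "mul (bullet A) (tens (bullet A) (bullet A) (?F c) (?F d)) \<in> Lin A base"
      by (intro conv_in_Lin A(1,10) Lin)
    fix x assume x: "x \<in> carrier A"
    obtain a b and n :: nat where ab: "\<And>i. a i \<in> carrier A" "\<And>i. b i \<in> carrier A"
      and n: "comul A x = (\<Sum>i<n. tens A A (a i) (b i))"
      by (rule tensor_expand[OF A(1) A(1) A(12)[OF x]]) (rule that)
    note B = is_vspace_bullet[of C]
    \<comment> \<open>Comultiplicativity of f is read off at the pair (c, d): one evaluation of the
      coproduct of \<open>f x\<close> gives its value at the product cd, another gives the
      convolution at x.\<close>
    have "?F (mul C (tens C C c d)) x =
        lift (bullet C) (bullet C) base (\<lambda>g h. g c * h d) (comul (bullet C) (f x))"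
      unfolding F by (rule bullet_comul(2)[OF C(1,2) f_in[OF x] c d, symmetric])
    also have "\<dots> = (\<Sum>i<n. f (a i) c * f (b i) d)"
      unfolding coalgebra_map_comul_sum[OF A(1) MorD(4)[OF f] x ab n]
      by (rule lift_sum[OF B B is_vspace_base])
        (intro bilinear_map_mult linear_map_apply bullet_simps f_in ab)+
    also have "\<dots> = mul (bullet A) (tens (bullet A) (bullet A) (?F c) (?F d)) x"
      unfolding conv_sum[OF A(1) Lin Lin x ab n] F ..
    finally show "?F (mul C (tens C C c d)) x =
        mul (bullet A) (tens (bullet A) (bullet A) (?F c) (?F d)) x" .
  qed
  moreover have "?F (unit C 1) = unit (bullet A) 1"
  proof
    fix x show "?F (unit C 1) x = unit (bullet A) 1 x"
      unfolding F bullet_unit_apply using f_counit f_zero by simp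
  qed
  ultimately have alg: "algebra_map C (bullet A) ?F"
    using lin by (simp only: algebra_map_iff[OF C(5) BA(5)]) blast
  have "?F \<in> Lin C (bullet A)" using lin zero by (simp add: Lin_def adj_def fun_eq_iff)
  thus ?thesis using alg coalg by (simp add: Mor_def)
qed

text \<open>Swapping two arguments twice is the identity, and \<open>bialgebra\<close> is imposed on
  both objects alike, so \<open>adj_in_Mor\<close> with the objects exchanged supplies the
  inverse.\<close>

lemma bij_betw_adj:
  assumes "bialgebra A" "bialgebra C"
  shows "bij_betw adj (Mor A (bullet C)) (Mor C (bullet A))"
  by (rule bij_betw_byWitness[where f' = adj])
    (use adj_in_Mor[OF assms] adj_in_Mor[OF assms(2,1)] in \<open>auto simp: adj_def\<close>)

section \<open>Functoriality and naturality\<close>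

lemma bullet_map_id:
  assumes "is_vspace C"
  shows "bullet_map C C (id_map C) = id_map (bullet C)"
proof
  fix h
  have "transpose_map C (id_map C) h = h" if "h \<in> carrier (bullet C)"
    using LinD(2)[OF bullet_in_Lin[OF assms that]] by (auto simp: transpose_map_def id_map_def)
  thus "bullet_map C C (id_map C) h = id_map (bullet C) h" by (simp add: bullet_map_def id_map_def)
qed

text \<open>\<open>bullet_map\<close> is set to zero outside the dual object, so the intermediate
  functional must be known to lie in \<open>bullet C'\<close>; \<open>bullet_map_in_Mor\<close>
  provides this.\<close>

lemma bullet_map_comp:
  fixes C :: "('k::field, 'c::ab_group_add) bistruct" and C' :: "('k, 'd::ab_group_add) bistruct"
    and C'' :: "('k, 'e::ab_group_add) bistruct"
  assumes C': "bialgebra C'" "bialgebra C''" and g: "linear_map C C' g" and g': "g' \<in> Mor C' C''"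
  shows "bullet_map C C'' (g' \<circ> g) = bullet_map C C' g \<circ> bullet_map C' C'' g'"
proof
  fix h
  show "bullet_map C C'' (g' \<circ> g) h = (bullet_map C C' g \<circ> bullet_map C' C'' g') h"
  proof (cases "h \<in> carrier (bullet C'')")
    case True
    hence "bullet_map C' C'' g' h \<in> carrier (bullet C')"
      using linear_map_closed[OF MorD(2)[OF bullet_map_in_Mor[OF C' g']]] by blast
    thus ?thesis using True linear_map_closed[OF g] by (auto simp: bullet_map_def transpose_map_def)
  qed (auto simp: bullet_map_def transpose_map_def)
qed

text \<open>On carriers both sides are f followed by h with the arguments swapped. Off carriers the
  normalisations must match: \<open>adj h c\<close> lies in \<open>bullet A'\<close> for every c,
  and h sends the default value 0 of f to 0.\<close>

lemma adj_comp_left: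
  assumes A: "is_vspace A'" and A': "bialgebra A'" and C: "bialgebra C" and f: "f \<in> Lin A A'"
    and h: "h \<in> Mor A' (bullet C)"
  shows "adj (h \<circ> f) = bullet_map A A' f \<circ> adj h"
proof (intro ext)
  fix c a
  have "adj h c \<in> carrier (bullet A')"
  proof (cases "c \<in> carrier C")
    case False
    hence "adj h c = 0" using LinD(2)[OF MorD(1)[OF adj_in_Mor[OF A' C h]]] by blast
    thus ?thesis using vspace_zero[OF is_vspace_bullet[of A']] by simp
  qed (rule linear_map_closed[OF MorD(2)[OF adj_in_Mor[OF A' C h]]])
  moreover have "h 0 = 0" by (rule linear_map_zero[OF A MorD(2)[OF h]])
  ultimately show "adj (h \<circ> f) c a = (bullet_map A A' f \<circ> adj h) c a"
    using LinD(2)[OF f] by (auto simp: adj_def bullet_map_def transpose_map_def)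
qed

text \<open>The same comparison of default values on the coalgebra side: off
  \<open>carrier C\<close> the map g takes the value 0, where the linear functional
  \<open>h a\<close> vanishes.\<close>

lemma adj_comp_right:
  assumes C': "is_vspace C'" and g: "g \<in> Lin C C'" and h: "h \<in> Mor A (bullet C')"
  shows "adj (bullet_map C C' g \<circ> h) = adj h \<circ> g"
proof (intro ext)
  fix c a
  have h_in: "h a \<in> carrier (bullet C')"
    using linear_map_closed[OF MorD(2)[OF h]] LinD(2)[OF MorD(1)[OF h]]
      vspace_zero[OF is_vspace_bullet[of C']] by (cases "a \<in> carrier A") auto
  moreover have "h a 0 = 0"
    by (rule linear_map_zero[OF C' LinD(1)[OF bullet_in_Lin[OF C' h_in]]])
  ultimately show "adj (bullet_map C C' g \<circ> h) c a = (adj h \<circ> g) c a"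
    using LinD(2)[OF g] by (auto simp: adj_def bullet_map_def transpose_map_def)
qed

theorem theorem4p4:
  fixes A :: "('k::field, 'a::ab_group_add) bistruct"
    and A' :: "('k, 'a1::ab_group_add) bistruct"
    and A'' :: "('k, 'a2::ab_group_add) bistruct"
    and C :: "('k, 'c::ab_group_add) bistruct"
    and C' :: "('k, 'c1::ab_group_add) bistruct"
    and C'' :: "('k, 'c2::ab_group_add) bistruct"
  assumes "NCoalg_Alg A" "NCoalg_Alg A'" "NCoalg_Alg A''"
    and "NAlg_Coalg C" "NAlg_Coalg C'" "NAlg_Coalg C''"
  shows
    \<comment> \<open>\<open>(-)\<^sup>\<bullet>\<close> is a contravariant functor from \<open>NAlg(Coalg)\<close> to \<open>NCoalg(Alg)\<close>;
      \<open>(-)\<^sup>\<circ>\<close> is a contravariant functor from \<open>NCoalg(Alg)\<close> to \<open>NAlg(Coalg)\<close>;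
      \<open>adj\<close> is a bijection of morphism sets, natural in \<open>A\<close> and in \<open>C\<close>\<close>
    "(NCoalg_Alg (bullet C) \<and>
      (\<forall>g \<in> Mor C C'. bullet_map C C' g \<in> Mor (bullet C') (bullet C)) \<and>
      bullet_map C C (id_map C) = id_map (bullet C) \<and>
      (\<forall>g \<in> Mor C C'. \<forall>g' \<in> Mor C' C''.
         bullet_map C C'' (g' \<circ> g) = bullet_map C C' g \<circ> bullet_map C' C'' g')) \<and>
     (NAlg_Coalg (circ A) \<and>
      (\<forall>f \<in> Mor A A'. circ_map A A' f \<in> Mor (circ A') (circ A)) \<and>
      circ_map A A (id_map A) = id_map (circ A) \<and>
      (\<forall>f \<in> Mor A A'. \<forall>f' \<in> Mor A' A''.
         circ_map A A'' (f' \<circ> f) = circ_map A A' f \<circ> circ_map A' A'' f')) \<and>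
     (bij_betw adj (Mor A (bullet C)) (Mor C (circ A)) \<and>
      (\<forall>f \<in> Mor A A'. \<forall>h \<in> Mor A' (bullet C). adj (h \<circ> f) = circ_map A A' f \<circ> adj h) \<and>
      (\<forall>g \<in> Mor C C'. \<forall>h \<in> Mor A (bullet C'). adj (bullet_map C C' g \<circ> h) = adj h \<circ> g))"
proof -
  note A = assms(1-3)[unfolded NCoalg_Alg_iff, THEN conjunct1]
  note C = assms(4-6)[unfolded NAlg_Coalg_iff, THEN conjunct1]
  note AV = A[THEN bialgebraD(1), THEN nonassoc_algebraD(1)]
  note CV = C[THEN bialgebraD(1), THEN nonassoc_algebraD(1)]
  show ?thesis
  proof (intro conjI ballI)
    show "NCoalg_Alg (bullet C)"
      using assms(4) by (simp add: NAlg_Coalg_iff NCoalg_Alg_iff bialgebra_bullet associative_bullet)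
    show "NAlg_Coalg (bullet A)"
      using assms(1) by (simp add: NAlg_Coalg_iff NCoalg_Alg_iff bialgebra_bullet coassociative_bullet
          bialgebraD(1))
    show "bij_betw adj (Mor A (bullet C)) (Mor C (bullet A))" by (rule bij_betw_adj[OF A(1) C(1)])
    show "bullet_map C C (id_map C) = id_map (bullet C)" by (rule bullet_map_id[OF CV(1)])
    show "bullet_map A A (id_map A) = id_map (bullet A)" by (rule bullet_map_id[OF AV(1)])
  next
    fix g assume g: "g \<in> Mor C C'"
    show "bullet_map C C' g \<in> Mor (bullet C') (bullet C)" by (rule bullet_map_in_Mor[OF C(1,2) g])
    fix g' assume "g' \<in> Mor C' C''"
    thus "bullet_map C C'' (g' \<circ> g) = bullet_map C C' g \<circ> bullet_map C' C'' g'"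
      by (rule bullet_map_comp[OF C(2,3) MorD(2)[OF g]])
  next
    fix f assume f: "f \<in> Mor A A'"
    show "bullet_map A A' f \<in> Mor (bullet A') (bullet A)" by (rule bullet_map_in_Mor[OF A(1,2) f])
    fix f' assume "f' \<in> Mor A' A''"
    thus "bullet_map A A'' (f' \<circ> f) = bullet_map A A' f \<circ> bullet_map A' A'' f'"
      by (rule bullet_map_comp[OF A(2,3) MorD(2)[OF f]])
  next
    fix f h assume "f \<in> Mor A A'" "h \<in> Mor A' (bullet C)"
    thus "adj (h \<circ> f) = bullet_map A A' f \<circ> adj h"
      by (intro adj_comp_left[OF AV(2) A(2) C(1)] MorD(1))
  next
    fix g h assume "g \<in> Mor C C'" "h \<in> Mor A (bullet C')"
    thus "adj (bullet_map C C' g \<circ> h) = adj h \<circ> g"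
      by (intro adj_comp_right[OF CV(2)] MorD(1))
  qed
qed

end
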